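(* A sequent $\Gamma\vdash\Delta$ is derivable in $LS_{BBI}$ if and only if it is derivable in $ILS_{BBI}$.
   Context: BBI formulae: $A ::= p \mid \top \mid \bot \mid \neg A \mid A\lor A \mid A\land A \mid A\to A \mid \top^* \mid A * A \mid A \mathrel{-\!*} A$, $p$ atomic; $\neg A$ abbreviates $A\to\bot$ and $A\lor B$ abbreviates $\neg(\neg A\land\neg B)$. Labels are label variables (from an infinite set $LVar$) or the constant $\epsilon$. A labelled formula is $w:A$; a relational atom is $(x,y\triangleright z)$ for labels $x,y,z$. A sequent $\Gamma\vdash\Delta$ has $\Gamma$ a finite multiset of labelled formulae and relational atoms and $\Delta$ a finite multiset of labelled formulae; ";" is multiset union. $\Gamma[y/x]$ replaces every occurrence of label $x$ by $y$. Rules of $LS_{BBI}$ ("from premises infer conclusion"; $P$ atomic): id: infer $\Gamma;w:P\vdash w:P;\Delta$. $\bot L$: infer $\Gamma;w:\bot\vdash\Delta$. $\top R$: infer $\Gamma\vdash w:\top;\Delta$. $\top^*R$: infer $\Gamma\vdash\epsilon:\top^*;\Delta$. cut: from $\Gamma\vdash x:A;\Delta$ and $\Gamma';x:A\vdash\Delta'$ infer $\Gamma;\Gamma'\vdash\Delta;\Delta'$. $\top^*L$: from $\Gamma[\epsilon/w]\vdash\Delta[\epsilon/w]$ infer $\Gamma;w:\top^*\vdash\Delta$ ($w\neq\epsilon$). $\land L$: from $\Gamma;w:A;w:B\vdash\Delta$ infer $\Gamma;w:A\land B\vdash\Delta$. $\land R$: from $\Gamma\vdash w:A;\Delta$ and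 $\Gamma\vdash w:B;\Delta$ infer $\Gamma\vdash w:A\land B;\Delta$. $\to L$: from $\Gamma\vdash w:A;\Delta$ and $\Gamma;w:B\vdash\Delta$ infer $\Gamma;w:A\to B\vdash\Delta$. $\to R$: from $\Gamma;w:A\vdash w:B;\Delta$ infer $\Gamma\vdash w:A\to B;\Delta$. $*L$: from $(x,y\triangleright z);\Gamma;x:A;y:B\vdash\Delta$ infer $\Gamma;z:A*B\vdash\Delta$ ($x,y$ not in the conclusion). $\mathrel{-\!*}R$: from $(x,y\triangleright z);\Gamma;x:A\vdash z:B;\Delta$ infer $\Gamma\vdash y:A\mathrel{-\!*}B;\Delta$ ($x,z$ not in the conclusion). $*R$: from $(x,y\triangleright z);\Gamma\vdash x:A;z:A*B;\Delta$ and $(x,y\triangleright z);\Gamma\vdash y:B;z:A*B;\Delta$ infer $(x,y\triangleright z);\Gamma\vdash z:A*B;\Delta$. $\mathrel{-\!*}L$: from $(x,y\triangleright z);\Gamma;y:A\mathrel{-\!*}B\vdash x:A;\Delta$ and $(x,y\triangleright z);\Gamma;y:A\mathrel{-\!*}B;z:B\vdash\Delta$ infer $(x,y\triangleright z);\Gamma;y:A\mathrel{-\!*}B\vdash\Delta$. E: from $(y,x\triangleright z);(x,y\triangleright z);\Gamma\vdash\Delta$ infer $(x,y\triangleright z);\Gamma\vdash\Delta$. U: from $(x,\epsilon\triangleright x);\Gamma\vdash\Delta$ infer $\Gamma\vdash\Delta$. A: from $(u,w\triangleright z);(y,v\triangleright w);(x,y\triangleright z);(u,v\triangleright x);\Gamma\vdash\Delta$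 infer $(x,y\triangleright z);(u,v\triangleright x);\Gamma\vdash\Delta$ ($w$ not in the conclusion). $A_C$: from $(x,w\triangleright x);(y,y\triangleright w);(x,y\triangleright x);\Gamma\vdash\Delta$ infer $(x,y\triangleright x);\Gamma\vdash\Delta$ ($w$ not in the conclusion). $Eq_1$: from $(\epsilon,w'\triangleright w');\Gamma[w'/w]\vdash\Delta[w'/w]$ infer $(\epsilon,w\triangleright w');\Gamma\vdash\Delta$ ($w\neq\epsilon$). $Eq_2$: from $(\epsilon,w'\triangleright w');\Gamma[w'/w]\vdash\Delta[w'/w]$ infer $(\epsilon,w'\triangleright w);\Gamma\vdash\Delta$ ($w\neq\epsilon$). Equality entailment. An instance of $Eq_1$ acting on a set $\mathcal{G}$ of relational atoms is given by a principal atom $(\epsilon,w\triangleright w')\in\mathcal{G}$ with $w\ne\epsilon$, its substitution $\theta=[w'/w]$ and added atom $(\epsilon,w'\triangleright w')$; an instance of $Eq_2$ is given by $(\epsilon,w'\triangleright w)\in\mathcal{G}$ with $w\neq\epsilon$, $\theta=[w'/w]$, added atom $(\epsilon,w'\triangleright w')$. For a sequence $\sigma$ of such instances, $\mathcal{S}(\mathcal{G},[\,])=\mathcal{G}$ and $\mathcal{S}(\mathcal{G},[r;\sigma'])=\mathcal{S}(\mathcal{G}\theta\cup\{\text{added atom of }r\},\sigma')$ if the principal atom of $r$ lies in $\mathcal{G}$ (undefined otherwise), where $\theta$ is $r$'s substitution. $subst(\sigma)$ is the composite $\theta_1\circ\cdots\circ\theta_n$ of the substitutions of $\sigma$ in order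 (apply $\theta_1$ first). $\mathcal{G}\vdash_E(u=v)$ holds iff there is such a sequence $\sigma$ with $\mathcal{S}(\mathcal{G},\sigma)$ defined and $u\theta=v\theta$ where $\theta=subst(\sigma)$. $ILS_{BBI}$ is the cut-free calculus with the rules $\bot L$, $\top R$, $\land L$, $\land R$, $\to L$, $\to R$, $*L$, $\mathrel{-\!*}R$, E, U of $LS_{BBI}$ (unchanged), no $Eq_1$, $Eq_2$ or cut, and the following rules, where in each rule $\mathcal{G}$ denotes the set of relational atoms in the antecedent of the conclusion: id: infer $\Gamma;w_1:P\vdash w_2:P;\Delta$ provided $\mathcal{G}\vdash_E(w_1=w_2)$. $\top^*L$: from $(\epsilon,w\triangleright\epsilon);\Gamma\vdash\Delta$ infer $\Gamma;w:\top^*\vdash\Delta$. $\top^*R$: infer $\Gamma\vdash w:\top^*;\Delta$ provided $\mathcal{G}\vdash_E(w=\epsilon)$. $*R$: from $(x,y\triangleright z');\Gamma\vdash x:A;z:A*B;\Delta$ and $(x,y\triangleright z');\Gamma\vdash y:B;z:A*B;\Delta$ infer $(x,y\triangleright z');\Gamma\vdash z:A*B;\Delta$ provided $\mathcal{G}\vdash_E(z=z')$. $\mathrel{-\!*}L$: from $(x,y'\triangleright z);\Gamma;y:A\mathrel{-\!*}B\vdash x:A;\Delta$ and $(x,y'\triangleright z);\Gamma;y:A\mathrel{-\!*}B;z:B\vdash\Delta$ infer $(x,y'\triangleright z);\Gamma;y:A\mathrel{-\!*}B\vdash\Delta$ provided $\mathcal{G}\vdash_E(y=y')$. A: from $(u,w\triangleright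 z);(y,v\triangleright w);(x,y\triangleright z);(u,v\triangleright x');\Gamma\vdash\Delta$ infer $(x,y\triangleright z);(u,v\triangleright x');\Gamma\vdash\Delta$ provided $\mathcal{G}\vdash_E(x=x')$, $w$ not in the conclusion. $A_C$: from $(x,w\triangleright x');(y,y\triangleright w);(x,y\triangleright x');\Gamma\vdash\Delta$ infer $(x,y\triangleright x');\Gamma\vdash\Delta$ provided $\mathcal{G}\vdash_E(x=x')$, $w$ not in the conclusion. *)

theory Defs
  imports "HOL-Library.Multiset" "HOL-Library.Infinite_Typeclass"
begin

datatype 'p form =
    Atom 'p
  | Top
  | Bot
  | And "'p form" "'p form"  (infixr "\<^bold>\<and>" 65)
  | Imp "'p form" "'p form"  (infixr "\<^bold>\<rightarrow>" 60)
  | TopStar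
  | Star "'p form" "'p form"  (infixr "\<^bold>*" 70)
  | Wand "'p form" "'p form"  (infixr "-\<^bold>*" 60)

abbreviation Neg :: "'p form \<Rightarrow> 'p form"  ("\<^bold>\<not>_" [80] 80) where
  "\<^bold>\<not>A \<equiv> A \<^bold>\<rightarrow> Bot"

abbreviation Or :: "'p form \<Rightarrow> 'p form \<Rightarrow> 'p form"  (infixr "\<^bold>\<or>" 62) where
  "A \<^bold>\<or> B \<equiv> \<^bold>\<not>(\<^bold>\<not>A \<^bold>\<and> \<^bold>\<not>B)"

datatype 'v label = Eps  ("\<epsilon>") | Var 'v

text \<open>The next three types are parametric in the type of labels, so that their map
  functions rename labels and their set functions collect the labels that occur.\<close>

datatype ('l, dead 'p) lform = LForm 'l "'p form"  (infix "\<^bold>:" 55)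

datatype 'l ratom = Rel 'l 'l 'l  ("'(_,/ _/ \<triangleright> _')")

datatype ('l, dead 'p) item = Fm "('l, 'p) lform" | At "'l ratom"

type_synonym ('v, 'p) ant = "('v label, 'p) item multiset"
type_synonym ('v, 'p) suc = "('v label, 'p) lform multiset"

text \<open>\<open>sub y x\<close> is the label substitution \<open>[y/x]\<close>.\<close>

definition sub :: "'v label \<Rightarrow> 'v label \<Rightarrow> 'v label \<Rightarrow> 'v label" where
  "sub y x = id(x := y)"

definition ant_map :: "('v label \<Rightarrow> 'v label) \<Rightarrow> ('v, 'p) ant \<Rightarrow> ('v, 'p) ant" where
  "ant_map \<theta> \<Gamma> = image_mset (map_item \<theta>) \<Gamma>"

definition suc_map :: "('v label \<Rightarrow> 'v label) \<Rightarrow> ('v, 'p) suc \<Rightarrow> ('v, 'p) suc" where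
  "suc_map \<theta> \<Delta> = image_mset (map_lform \<theta>) \<Delta>"

definition labels :: "('v, 'p) ant \<Rightarrow> ('v, 'p) suc \<Rightarrow> 'v label set" where
  "labels \<Gamma> \<Delta> = (\<Union>i\<in>set_mset \<Gamma>. set_item i) \<union> (\<Union>f\<in>set_mset \<Delta>. set_lform f)"

definition ratoms :: "('v, 'p) ant \<Rightarrow> 'v label ratom set" where
  "ratoms \<Gamma> = {a. At a \<in># \<Gamma>}"

text \<open>Eigenlabels are label variables, hence different from \<open>\<epsilon>\<close>, and the two eigenlabels
  of \<open>StarL\<close> and of \<open>WandR\<close> are distinct; both are required for soundness.\<close>

inductive LS :: "('v, 'p) ant \<Rightarrow> ('v, 'p) suc \<Rightarrow> bool"  (infix "\<turnstile>\<^sub>L\<^sub>S" 50) where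
  Id: "add_mset (Fm (w \<^bold>: Atom P)) \<Gamma> \<turnstile>\<^sub>L\<^sub>S add_mset (w \<^bold>: Atom P) \<Delta>"
| Cut: "\<Gamma> \<turnstile>\<^sub>L\<^sub>S add_mset (x \<^bold>: A) \<Delta> \<Longrightarrow> add_mset (Fm (x \<^bold>: A)) \<Gamma>' \<turnstile>\<^sub>L\<^sub>S \<Delta>'
    \<Longrightarrow> \<Gamma> + \<Gamma>' \<turnstile>\<^sub>L\<^sub>S \<Delta> + \<Delta>'"
| BotL: "add_mset (Fm (w \<^bold>: Bot)) \<Gamma> \<turnstile>\<^sub>L\<^sub>S \<Delta>"
| TopR: "\<Gamma> \<turnstile>\<^sub>L\<^sub>S add_mset (w \<^bold>: Top) \<Delta>"
| TopStarL: "ant_map (sub \<epsilon> w) \<Gamma> \<turnstile>\<^sub>L\<^sub>S suc_map (sub \<epsilon> w) \<Delta> \<Longrightarrow> w \<noteq> \<epsilon>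
    \<Longrightarrow> add_mset (Fm (w \<^bold>: TopStar)) \<Gamma> \<turnstile>\<^sub>L\<^sub>S \<Delta>"
| TopStarR: "\<Gamma> \<turnstile>\<^sub>L\<^sub>S add_mset (\<epsilon> \<^bold>: TopStar) \<Delta>"
| AndL: "add_mset (Fm (w \<^bold>: A)) (add_mset (Fm (w \<^bold>: B)) \<Gamma>) \<turnstile>\<^sub>L\<^sub>S \<Delta>
    \<Longrightarrow> add_mset (Fm (w \<^bold>: A \<^bold>\<and> B)) \<Gamma> \<turnstile>\<^sub>L\<^sub>S \<Delta>"
| AndR: "\<Gamma> \<turnstile>\<^sub>L\<^sub>S add_mset (w \<^bold>: A) \<Delta> \<Longrightarrow> \<Gamma> \<turnstile>\<^sub>L\<^sub>S add_mset (w \<^bold>: B) \<Delta>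
    \<Longrightarrow> \<Gamma> \<turnstile>\<^sub>L\<^sub>S add_mset (w \<^bold>: A \<^bold>\<and> B) \<Delta>"
| ImpL: "\<Gamma> \<turnstile>\<^sub>L\<^sub>S add_mset (w \<^bold>: A) \<Delta> \<Longrightarrow> add_mset (Fm (w \<^bold>: B)) \<Gamma> \<turnstile>\<^sub>L\<^sub>S \<Delta>
    \<Longrightarrow> add_mset (Fm (w \<^bold>: A \<^bold>\<rightarrow> B)) \<Gamma> \<turnstile>\<^sub>L\<^sub>S \<Delta>"
| ImpR: "add_mset (Fm (w \<^bold>: A)) \<Gamma> \<turnstile>\<^sub>L\<^sub>S add_mset (w \<^bold>: B) \<Delta>
    \<Longrightarrow> \<Gamma> \<turnstile>\<^sub>L\<^sub>S add_mset (w \<^bold>: A \<^bold>\<rightarrow> B) \<Delta>"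
| StarL: "add_mset (At (Var x, Var y \<triangleright> z))
      (add_mset (Fm (Var x \<^bold>: A)) (add_mset (Fm (Var y \<^bold>: B)) \<Gamma>)) \<turnstile>\<^sub>L\<^sub>S \<Delta>
    \<Longrightarrow> Var x \<notin> labels (add_mset (Fm (z \<^bold>: A \<^bold>* B)) \<Gamma>) \<Delta>
    \<Longrightarrow> Var y \<notin> labels (add_mset (Fm (z \<^bold>: A \<^bold>* B)) \<Gamma>) \<Delta> \<Longrightarrow> x \<noteq> y
    \<Longrightarrow> add_mset (Fm (z \<^bold>: A \<^bold>* B)) \<Gamma> \<turnstile>\<^sub>L\<^sub>S \<Delta>"
| WandR: "add_mset (At (Var x, y \<triangleright> Var z)) (add_mset (Fm (Var x \<^bold>: A)) \<Gamma>)
      \<turnstile>\<^sub>L\<^sub>S add_mset (Var z \<^bold>: B) \<Delta>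
    \<Longrightarrow> Var x \<notin> labels \<Gamma> (add_mset (y \<^bold>: A -\<^bold>* B) \<Delta>)
    \<Longrightarrow> Var z \<notin> labels \<Gamma> (add_mset (y \<^bold>: A -\<^bold>* B) \<Delta>) \<Longrightarrow> x \<noteq> z
    \<Longrightarrow> \<Gamma> \<turnstile>\<^sub>L\<^sub>S add_mset (y \<^bold>: A -\<^bold>* B) \<Delta>"
| StarR: "add_mset (At (x, y \<triangleright> z)) \<Gamma> \<turnstile>\<^sub>L\<^sub>S add_mset (x \<^bold>: A) (add_mset (z \<^bold>: A \<^bold>* B) \<Delta>)
    \<Longrightarrow> add_mset (At (x, y \<triangleright> z)) \<Gamma> \<turnstile>\<^sub>L\<^sub>S add_mset (y \<^bold>: B) (add_mset (z \<^bold>: A \<^bold>* B) \<Delta>)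
    \<Longrightarrow> add_mset (At (x, y \<triangleright> z)) \<Gamma> \<turnstile>\<^sub>L\<^sub>S add_mset (z \<^bold>: A \<^bold>* B) \<Delta>"
| WandL: "add_mset (At (x, y \<triangleright> z)) (add_mset (Fm (y \<^bold>: A -\<^bold>* B)) \<Gamma>)
      \<turnstile>\<^sub>L\<^sub>S add_mset (x \<^bold>: A) \<Delta>
    \<Longrightarrow> add_mset (At (x, y \<triangleright> z)) (add_mset (Fm (y \<^bold>: A -\<^bold>* B)) (add_mset (Fm (z \<^bold>: B)) \<Gamma>))
      \<turnstile>\<^sub>L\<^sub>S \<Delta>
    \<Longrightarrow> add_mset (At (x, y \<triangleright> z)) (add_mset (Fm (y \<^bold>: A -\<^bold>* B)) \<Gamma>) \<turnstile>\<^sub>L\<^sub>S \<Delta>"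
| E: "add_mset (At (y, x \<triangleright> z)) (add_mset (At (x, y \<triangleright> z)) \<Gamma>) \<turnstile>\<^sub>L\<^sub>S \<Delta>
    \<Longrightarrow> add_mset (At (x, y \<triangleright> z)) \<Gamma> \<turnstile>\<^sub>L\<^sub>S \<Delta>"
| U: "add_mset (At (x, \<epsilon> \<triangleright> x)) \<Gamma> \<turnstile>\<^sub>L\<^sub>S \<Delta> \<Longrightarrow> \<Gamma> \<turnstile>\<^sub>L\<^sub>S \<Delta>"
| A: "add_mset (At (u, Var w \<triangleright> z)) (add_mset (At (y, v \<triangleright> Var w))
      (add_mset (At (x, y \<triangleright> z)) (add_mset (At (u, v \<triangleright> x)) \<Gamma>))) \<turnstile>\<^sub>L\<^sub>S \<Delta>
    \<Longrightarrow> Var w \<notin> labels (add_mset (At (x, y \<triangleright> z)) (add_mset (At (u, v \<triangleright> x)) \<Gamma>)) \<Delta>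
    \<Longrightarrow> add_mset (At (x, y \<triangleright> z)) (add_mset (At (u, v \<triangleright> x)) \<Gamma>) \<turnstile>\<^sub>L\<^sub>S \<Delta>"
| AC: "add_mset (At (x, Var w \<triangleright> x)) (add_mset (At (y, y \<triangleright> Var w))
      (add_mset (At (x, y \<triangleright> x)) \<Gamma>)) \<turnstile>\<^sub>L\<^sub>S \<Delta>
    \<Longrightarrow> Var w \<notin> labels (add_mset (At (x, y \<triangleright> x)) \<Gamma>) \<Delta>
    \<Longrightarrow> add_mset (At (x, y \<triangleright> x)) \<Gamma> \<turnstile>\<^sub>L\<^sub>S \<Delta>"
| Eq1: "add_mset (At (\<epsilon>, w' \<triangleright> w')) (ant_map (sub w' w) \<Gamma>) \<turnstile>\<^sub>L\<^sub>S suc_map (sub w' w) \<Delta>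
    \<Longrightarrow> w \<noteq> \<epsilon> \<Longrightarrow> add_mset (At (\<epsilon>, w \<triangleright> w')) \<Gamma> \<turnstile>\<^sub>L\<^sub>S \<Delta>"
| Eq2: "add_mset (At (\<epsilon>, w' \<triangleright> w')) (ant_map (sub w' w) \<Gamma>) \<turnstile>\<^sub>L\<^sub>S suc_map (sub w' w) \<Delta>
    \<Longrightarrow> w \<noteq> \<epsilon> \<Longrightarrow> add_mset (At (\<epsilon>, w' \<triangleright> w)) \<Gamma> \<turnstile>\<^sub>L\<^sub>S \<Delta>"

text \<open>Instances of the rules \<open>Eq1\<close> and \<open>Eq2\<close>: \<open>Inst1 w w'\<close> has principal atom
  \<open>(\<epsilon>, w \<triangleright> w')\<close> and \<open>Inst2 w w'\<close> has principal atom \<open>(\<epsilon>, w' \<triangleright> w)\<close>.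
  Both substitute \<open>w'\<close> for \<open>w\<close>.\<close>

datatype 'v eq_inst = Inst1 "'v label" "'v label" | Inst2 "'v label" "'v label"

fun principal :: "'v eq_inst \<Rightarrow> 'v label ratom" where
  "principal (Inst1 w w') = (\<epsilon>, w \<triangleright> w')"
| "principal (Inst2 w w') = (\<epsilon>, w' \<triangleright> w)"

fun admissible :: "'v eq_inst \<Rightarrow> bool" where
  "admissible (Inst1 w w') \<longleftrightarrow> w \<noteq> \<epsilon>"
| "admissible (Inst2 w w') \<longleftrightarrow> w \<noteq> \<epsilon>"

fun inst_sub :: "'v eq_inst \<Rightarrow> 'v label \<Rightarrow> 'v label" where
  "inst_sub (Inst1 w w') = sub w' w"
| "inst_sub (Inst2 w w') = sub w' w"

fun added :: "'v eq_inst \<Rightarrow> 'v label ratom" where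
  "added (Inst1 w w') = (\<epsilon>, w' \<triangleright> w')"
| "added (Inst2 w w') = (\<epsilon>, w' \<triangleright> w')"

fun eq_run :: "'v label ratom set \<Rightarrow> 'v eq_inst list \<Rightarrow> 'v label ratom set option" where
  "eq_run G [] = Some G"
| "eq_run G (r # \<sigma>) =
    (if admissible r \<and> principal r \<in> G
     then eq_run (map_ratom (inst_sub r) ` G \<union> {added r}) \<sigma> else None)"

text \<open>The substitution of the first instance is applied first.\<close>

fun subst :: "'v eq_inst list \<Rightarrow> 'v label \<Rightarrow> 'v label" where
  "subst [] = id"
| "subst (r # \<sigma>) = subst \<sigma> \<circ> inst_sub r"

definition eq_entails :: "'v label ratom set \<Rightarrow> 'v label \<Rightarrow> 'v label \<Rightarrow> bool"
    ("_ \<turnstile>\<^sub>E '(_ = _')" [51, 51, 51] 50) where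
  "G \<turnstile>\<^sub>E (u = v) \<longleftrightarrow> (\<exists>\<sigma>. eq_run G \<sigma> \<noteq> None \<and> subst \<sigma> u = subst \<sigma> v)"

inductive ILS :: "('v, 'p) ant \<Rightarrow> ('v, 'p) suc \<Rightarrow> bool"  (infix "\<turnstile>\<^sub>I\<^sub>L\<^sub>S" 50) where
  Id: "ratoms (add_mset (Fm (w1 \<^bold>: Atom P)) \<Gamma>) \<turnstile>\<^sub>E (w1 = w2)
    \<Longrightarrow> add_mset (Fm (w1 \<^bold>: Atom P)) \<Gamma> \<turnstile>\<^sub>I\<^sub>L\<^sub>S add_mset (w2 \<^bold>: Atom P) \<Delta>"
| BotL: "add_mset (Fm (w \<^bold>: Bot)) \<Gamma> \<turnstile>\<^sub>I\<^sub>L\<^sub>S \<Delta>"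
| TopR: "\<Gamma> \<turnstile>\<^sub>I\<^sub>L\<^sub>S add_mset (w \<^bold>: Top) \<Delta>"
| TopStarL: "add_mset (At (\<epsilon>, w \<triangleright> \<epsilon>)) \<Gamma> \<turnstile>\<^sub>I\<^sub>L\<^sub>S \<Delta>
    \<Longrightarrow> add_mset (Fm (w \<^bold>: TopStar)) \<Gamma> \<turnstile>\<^sub>I\<^sub>L\<^sub>S \<Delta>"
| TopStarR: "ratoms \<Gamma> \<turnstile>\<^sub>E (w = \<epsilon>) \<Longrightarrow> \<Gamma> \<turnstile>\<^sub>I\<^sub>L\<^sub>S add_mset (w \<^bold>: TopStar) \<Delta>"
| AndL: "add_mset (Fm (w \<^bold>: A)) (add_mset (Fm (w \<^bold>: B)) \<Gamma>) \<turnstile>\<^sub>I\<^sub>L\<^sub>S \<Delta>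
    \<Longrightarrow> add_mset (Fm (w \<^bold>: A \<^bold>\<and> B)) \<Gamma> \<turnstile>\<^sub>I\<^sub>L\<^sub>S \<Delta>"
| AndR: "\<Gamma> \<turnstile>\<^sub>I\<^sub>L\<^sub>S add_mset (w \<^bold>: A) \<Delta> \<Longrightarrow> \<Gamma> \<turnstile>\<^sub>I\<^sub>L\<^sub>S add_mset (w \<^bold>: B) \<Delta>
    \<Longrightarrow> \<Gamma> \<turnstile>\<^sub>I\<^sub>L\<^sub>S add_mset (w \<^bold>: A \<^bold>\<and> B) \<Delta>"
| ImpL: "\<Gamma> \<turnstile>\<^sub>I\<^sub>L\<^sub>S add_mset (w \<^bold>: A) \<Delta> \<Longrightarrow> add_mset (Fm (w \<^bold>: B)) \<Gamma> \<turnstile>\<^sub>I\<^sub>L\<^sub>S \<Delta>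
    \<Longrightarrow> add_mset (Fm (w \<^bold>: A \<^bold>\<rightarrow> B)) \<Gamma> \<turnstile>\<^sub>I\<^sub>L\<^sub>S \<Delta>"
| ImpR: "add_mset (Fm (w \<^bold>: A)) \<Gamma> \<turnstile>\<^sub>I\<^sub>L\<^sub>S add_mset (w \<^bold>: B) \<Delta>
    \<Longrightarrow> \<Gamma> \<turnstile>\<^sub>I\<^sub>L\<^sub>S add_mset (w \<^bold>: A \<^bold>\<rightarrow> B) \<Delta>"
| StarL: "add_mset (At (Var x, Var y \<triangleright> z))
      (add_mset (Fm (Var x \<^bold>: A)) (add_mset (Fm (Var y \<^bold>: B)) \<Gamma>)) \<turnstile>\<^sub>I\<^sub>L\<^sub>S \<Delta>
    \<Longrightarrow> Var x \<notin> labels (add_mset (Fm (z \<^bold>: A \<^bold>* B)) \<Gamma>) \<Delta>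
    \<Longrightarrow> Var y \<notin> labels (add_mset (Fm (z \<^bold>: A \<^bold>* B)) \<Gamma>) \<Delta> \<Longrightarrow> x \<noteq> y
    \<Longrightarrow> add_mset (Fm (z \<^bold>: A \<^bold>* B)) \<Gamma> \<turnstile>\<^sub>I\<^sub>L\<^sub>S \<Delta>"
| WandR: "add_mset (At (Var x, y \<triangleright> Var z)) (add_mset (Fm (Var x \<^bold>: A)) \<Gamma>)
      \<turnstile>\<^sub>I\<^sub>L\<^sub>S add_mset (Var z \<^bold>: B) \<Delta>
    \<Longrightarrow> Var x \<notin> labels \<Gamma> (add_mset (y \<^bold>: A -\<^bold>* B) \<Delta>)
    \<Longrightarrow> Var z \<notin> labels \<Gamma> (add_mset (y \<^bold>: A -\<^bold>* B) \<Delta>) \<Longrightarrow> x \<noteq> z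
    \<Longrightarrow> \<Gamma> \<turnstile>\<^sub>I\<^sub>L\<^sub>S add_mset (y \<^bold>: A -\<^bold>* B) \<Delta>"
| StarR: "add_mset (At (x, y \<triangleright> z')) \<Gamma> \<turnstile>\<^sub>I\<^sub>L\<^sub>S add_mset (x \<^bold>: A) (add_mset (z \<^bold>: A \<^bold>* B) \<Delta>)
    \<Longrightarrow> add_mset (At (x, y \<triangleright> z')) \<Gamma> \<turnstile>\<^sub>I\<^sub>L\<^sub>S add_mset (y \<^bold>: B) (add_mset (z \<^bold>: A \<^bold>* B) \<Delta>)
    \<Longrightarrow> ratoms (add_mset (At (x, y \<triangleright> z')) \<Gamma>) \<turnstile>\<^sub>E (z = z')
    \<Longrightarrow> add_mset (At (x, y \<triangleright> z')) \<Gamma> \<turnstile>\<^sub>I\<^sub>L\<^sub>S add_mset (z \<^bold>: A \<^bold>* B) \<Delta>"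
| WandL: "add_mset (At (x, y' \<triangleright> z)) (add_mset (Fm (y \<^bold>: A -\<^bold>* B)) \<Gamma>)
      \<turnstile>\<^sub>I\<^sub>L\<^sub>S add_mset (x \<^bold>: A) \<Delta>
    \<Longrightarrow> add_mset (At (x, y' \<triangleright> z)) (add_mset (Fm (y \<^bold>: A -\<^bold>* B)) (add_mset (Fm (z \<^bold>: B)) \<Gamma>))
      \<turnstile>\<^sub>I\<^sub>L\<^sub>S \<Delta>
    \<Longrightarrow> ratoms (add_mset (At (x, y' \<triangleright> z)) (add_mset (Fm (y \<^bold>: A -\<^bold>* B)) \<Gamma>)) \<turnstile>\<^sub>E (y = y')
    \<Longrightarrow> add_mset (At (x, y' \<triangleright> z)) (add_mset (Fm (y \<^bold>: A -\<^bold>* B)) \<Gamma>) \<turnstile>\<^sub>I\<^sub>L\<^sub>S \<Delta>"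
| E: "add_mset (At (y, x \<triangleright> z)) (add_mset (At (x, y \<triangleright> z)) \<Gamma>) \<turnstile>\<^sub>I\<^sub>L\<^sub>S \<Delta>
    \<Longrightarrow> add_mset (At (x, y \<triangleright> z)) \<Gamma> \<turnstile>\<^sub>I\<^sub>L\<^sub>S \<Delta>"
| U: "add_mset (At (x, \<epsilon> \<triangleright> x)) \<Gamma> \<turnstile>\<^sub>I\<^sub>L\<^sub>S \<Delta> \<Longrightarrow> \<Gamma> \<turnstile>\<^sub>I\<^sub>L\<^sub>S \<Delta>"
| A: "add_mset (At (u, Var w \<triangleright> z)) (add_mset (At (y, v \<triangleright> Var w))
      (add_mset (At (x, y \<triangleright> z)) (add_mset (At (u, v \<triangleright> x')) \<Gamma>))) \<turnstile>\<^sub>I\<^sub>L\<^sub>S \<Delta>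
    \<Longrightarrow> ratoms (add_mset (At (x, y \<triangleright> z)) (add_mset (At (u, v \<triangleright> x')) \<Gamma>)) \<turnstile>\<^sub>E (x = x')
    \<Longrightarrow> Var w \<notin> labels (add_mset (At (x, y \<triangleright> z)) (add_mset (At (u, v \<triangleright> x')) \<Gamma>)) \<Delta>
    \<Longrightarrow> add_mset (At (x, y \<triangleright> z)) (add_mset (At (u, v \<triangleright> x')) \<Gamma>) \<turnstile>\<^sub>I\<^sub>L\<^sub>S \<Delta>"
| AC: "add_mset (At (x, Var w \<triangleright> x')) (add_mset (At (y, y \<triangleright> Var w))
      (add_mset (At (x, y \<triangleright> x')) \<Gamma>)) \<turnstile>\<^sub>I\<^sub>L\<^sub>S \<Delta>
    \<Longrightarrow> ratoms (add_mset (At (x, y \<triangleright> x')) \<Gamma>) \<turnstile>\<^sub>E (x = x')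
    \<Longrightarrow> Var w \<notin> labels (add_mset (At (x, y \<triangleright> x')) \<Gamma>) \<Delta>
    \<Longrightarrow> add_mset (At (x, y \<triangleright> x')) \<Gamma> \<turnstile>\<^sub>I\<^sub>L\<^sub>S \<Delta>"

end

theory Submission
  imports Defs
begin

text \<open>From \<open>ILS\<close> to \<open>LS\<close>, a run witnessing an equality side condition is a sequence of backward
  applications of \<open>Eq1\<close> and \<open>Eq2\<close>. It replaces the conclusion of an \<open>ILS\<close> rule by its image under a
  substitution that identifies the two labels, and there the \<open>LS\<close> rule applies to the images of the
  premises.

  From \<open>LS\<close> to \<open>ILS\<close>, cut is eliminated semantically. The worlds of a model are the sequents
  themselves, ordered by extension, and the orthogonal of a set \<open>X\<close> of sequents consists of the
  sequents all of whose extensions in \<open>X\<close> are derivable in \<open>ILS\<close>. A labelled formula has a left and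
  a right meaning, each the orthogonal of the other, so that cut is sound. Labels are compared
  modulo the equality forced by the atoms of the sequent, so that \<open>Eq1\<close>, \<open>Eq2\<close> and \<open>TopStarL\<close> are sound.
  A sequent belongs to the left (right) meaning of every formula that occurs on its left (right), by
  the rules of \<open>ILS\<close>; hence soundness, applied to the end sequent as a world, yields an \<open>ILS\<close>
  derivation.\<close>

section \<open>Renaming labels\<close>

lemma ant_map_simps [simp]:
  "ant_map \<theta> {#} = {#}"
  "ant_map \<theta> (add_mset i \<Gamma>) = add_mset (map_item \<theta> i) (ant_map \<theta> \<Gamma>)"
  "ant_map \<theta> (\<Gamma> + \<Gamma>') = ant_map \<theta> \<Gamma> + ant_map \<theta> \<Gamma>'"
  by (simp_all add: ant_map_def)

lemma suc_map_simps [simp]: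
  "suc_map \<theta> {#} = {#}"
  "suc_map \<theta> (add_mset f \<Delta>) = add_mset (map_lform \<theta> f) (suc_map \<theta> \<Delta>)"
  "suc_map \<theta> (\<Delta> + \<Delta>') = suc_map \<theta> \<Delta> + suc_map \<theta> \<Delta>'"
  by (simp_all add: suc_map_def)

lemma labels_simps [simp]:
  "labels (add_mset i \<Gamma>) \<Delta> = set_item i \<union> labels \<Gamma> \<Delta>"
  "labels \<Gamma> (add_mset f \<Delta>) = set_lform f \<union> labels \<Gamma> \<Delta>"
  by (auto simp: labels_def)

lemma labels_union [simp]: "labels (\<Gamma> + \<Gamma>') (\<Delta> + \<Delta>') = labels \<Gamma> \<Delta> \<union> labels \<Gamma>' \<Delta>'"
  by (auto simp: labels_def)

lemma ratoms_simps [simp]: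
  "ratoms (add_mset (At a) \<Gamma>) = insert a (ratoms \<Gamma>)"
  "ratoms (add_mset (Fm f) \<Gamma>) = ratoms \<Gamma>"
  by (auto simp: ratoms_def)

lemma ratoms_ant_map: "ratoms (ant_map \<theta> \<Gamma>) = map_ratom \<theta> ` ratoms \<Gamma>"
proof -
  have "At a \<in> map_item \<theta> ` set_mset \<Gamma> \<longleftrightarrow> (\<exists>b. At b \<in># \<Gamma> \<and> a = map_ratom \<theta> b)" for a
  proof
    assume "At a \<in> map_item \<theta> ` set_mset \<Gamma>"
    then obtain i where "i \<in># \<Gamma>" "At a = map_item \<theta> i" by blast
    then show "\<exists>b. At b \<in># \<Gamma> \<and> a = map_ratom \<theta> b" by (cases i) auto
  qed (metis image_eqI item.map(2))
  then show ?thesis by (auto simp: ratoms_def ant_map_def)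
qed

section \<open>Finiteness and fresh labels\<close>

lemma finite_ratoms:
  fixes \<Gamma> :: "('v, 'p) ant"
  shows "finite (ratoms \<Gamma>)"
proof -
  have "(At :: 'v label ratom \<Rightarrow> ('v label, 'p) item) ` ratoms \<Gamma> \<subseteq> set_mset \<Gamma>" by (auto simp: ratoms_def)
  then have "finite ((At :: 'v label ratom \<Rightarrow> ('v label, 'p) item) ` ratoms \<Gamma>)"
    by (rule finite_subset) (rule finite_set_mset)
  then show ?thesis by (rule finite_imageD) (auto simp: inj_on_def)
qed

lemma finite_set_ratom: "finite (set_ratom a)"
  by (cases a) simp

lemma finite_labels: "finite (labels \<Gamma> \<Delta>)"
proof -
  have "finite (set_lform f)" for f :: "('v label, 'p) lform" by (cases f) auto
  then have "finite (set_item i)" for i :: "('v label, 'p) item"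
    by (cases i) (auto simp: finite_set_ratom)
  with \<open>\<And>f. finite (set_lform f)\<close> show ?thesis by (simp add: labels_def)
qed

lemma fresh_label:
  fixes F :: "'v::infinite label set"
  assumes "finite F"
  obtains x where "Var x \<notin> F"
proof -
  have "finite (Var -` F)" using assms by (auto intro: finite_vimageI simp: inj_on_def)
  then obtain x where "x \<notin> Var -` F" using ex_new_if_finite infinite_UNIV by blast
  then show ?thesis using that by auto
qed

lemma map_cong_labels:
  assumes "\<And>l. l \<in> labels \<Gamma> \<Delta> \<Longrightarrow> \<theta> l = \<theta>' l"
  shows "ant_map \<theta> \<Gamma> = ant_map \<theta>' \<Gamma>" and "suc_map \<theta> \<Delta> = suc_map \<theta>' \<Delta>"
proof -
  have "map_item \<theta> i = map_item \<theta>' i" if "i \<in># \<Gamma>" for i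
    using that assms by (intro item.map_cong0) (auto simp: labels_def)
  then show "ant_map \<theta> \<Gamma> = ant_map \<theta>' \<Gamma>" by (auto simp: ant_map_def intro: image_mset_cong)
  have "map_lform \<theta> f = map_lform \<theta>' f" if "f \<in># \<Delta>" for f
    using that assms by (intro lform.map_cong0) (auto simp: labels_def)
  then show "suc_map \<theta> \<Delta> = suc_map \<theta>' \<Delta>" by (auto simp: suc_map_def intro: image_mset_cong)
qed

lemma map_comp:
  "ant_map \<theta> (ant_map \<theta>' \<Gamma>) = ant_map (\<theta> \<circ> \<theta>') \<Gamma>"
  "suc_map \<theta> (suc_map \<theta>' \<Delta>) = suc_map (\<theta> \<circ> \<theta>') \<Delta>"
  by (simp_all add: ant_map_def suc_map_def multiset.map_comp item.map_comp lform.map_comp comp_def)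

lemma map_id [simp]: "ant_map id \<Gamma> = \<Gamma>" "suc_map id \<Delta> = \<Delta>"
  by (simp_all add: ant_map_def suc_map_def item.map_id0 lform.map_id0)

lemma sub_simps [simp]: "sub y x x = y" "z \<noteq> x \<Longrightarrow> sub y x z = z" "sub y x y = y"
  by (auto simp: sub_def)

lemma comp_sub: "\<theta> w = \<theta> w' \<Longrightarrow> \<theta> \<circ> sub w' w = \<theta>"
  by (auto simp: sub_def fun_eq_iff)

text \<open>A composite of \<open>\<theta>\<close> and \<open>s\<close> that identifies
  \<open>w\<close> and \<open>w'\<close> absorbs the substitution \<open>sub w' w\<close>. This is
  how renaming commutes with the rules that substitute in their premise. The existential hides the
  composite and leaves plain rewrite equations for \<open>\<phi>\<close>.\<close>

lemma rename_sub:
  assumes "s (\<theta> w) = s (\<theta> w')"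
  shows "\<exists>\<phi>. (\<forall>l. \<phi> l = s (\<theta> l))
    \<and> (\<forall>\<Gamma>. ant_map \<phi> (ant_map (sub w' w) \<Gamma>) = ant_map s (ant_map \<theta> \<Gamma>))
    \<and> (\<forall>\<Delta>. suc_map \<phi> (suc_map (sub w' w) \<Delta>) = suc_map s (suc_map \<theta> \<Delta>))"
proof -
  have "s \<circ> \<theta> \<circ> sub w' w = s \<circ> \<theta>" using assms by (intro comp_sub) simp
  then show ?thesis by (intro exI[of _ "s \<circ> \<theta>"]) (simp only: map_comp comp_apply simp_thms)
qed


section \<open>From \<open>ILS\<close> to \<open>LS\<close>\<close>

text \<open>Renaming and weakening need each other: added contexts force eigenlabels to be renamed,
  and a renaming that sends the label of \<open>TopStarL\<close> to \<epsilon> leaves behind a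
  formula that weakening has to supply. The renaming may identify labels.\<close>

lemma LS_rename_weaken:
  fixes \<Gamma> :: "('v::infinite, 'p) ant"
  assumes "\<Gamma> \<turnstile>\<^sub>L\<^sub>S \<Delta>" and "\<theta> \<epsilon> = \<epsilon>"
  shows "ant_map \<theta> \<Gamma> + \<Gamma>' \<turnstile>\<^sub>L\<^sub>S suc_map \<theta> \<Delta> + \<Delta>'"
  using assms
proof (induction arbitrary: \<theta> \<Gamma>' \<Delta>' rule: LS.induct)
  case (Cut \<Gamma>1 x A \<Delta>1 \<Gamma>2 \<Delta>2)
  \<comment> \<open>The conclusion of a cut adds up the contexts of its premises, so only the first
    premise is weakened.\<close>
  from LS.Cut[OF Cut.IH(1)[of \<theta> \<Gamma>' \<Delta>', simplified, OF Cut.prems]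
      Cut.IH(2)[of \<theta> "{#}" "{#}", simplified, OF Cut.prems]]
  show ?case by (simp add: ac_simps)
next
  case (TopStarL w \<Gamma> \<Delta>)
  show ?case
  \<comment> \<open>\<open>LS.TopStarL\<close> cannot act on \<epsilon>. If \<open>w\<close> is sent
    there, the renamed premise is the renamed conclusion up to weakening by \<open>TopStar\<close>
    at \<epsilon>.\<close>
  proof (cases "\<theta> w = \<epsilon>")
    case True
    then have "\<theta> \<circ> sub \<epsilon> w = \<theta>" using TopStarL.prems by (intro comp_sub) simp
    then show ?thesis
      using TopStarL.IH[of \<theta> "add_mset (Fm (\<epsilon> \<^bold>: TopStar)) \<Gamma>'" \<Delta>'] TopStarL.prems True
      by (simp add: map_comp)
  next
    case False
    have e: "sub \<epsilon> (\<theta> w) (\<theta> w) = sub \<epsilon> (\<theta> w) (\<theta> \<epsilon>)" using TopStarL.prems by simp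
    obtain \<phi> where \<phi>: "\<And>l. \<phi> l = sub \<epsilon> (\<theta> w) (\<theta> l)"
      "\<And>\<Gamma> :: ('v, 'p) ant. ant_map \<phi> (ant_map (sub \<epsilon> w) \<Gamma>) = ant_map (sub \<epsilon> (\<theta> w)) (ant_map \<theta> \<Gamma>)"
      "\<And>\<Delta> :: ('v, 'p) suc. suc_map \<phi> (suc_map (sub \<epsilon> w) \<Delta>) = suc_map (sub \<epsilon> (\<theta> w)) (suc_map \<theta> \<Delta>)"
      using rename_sub[of "sub \<epsilon> (\<theta> w)" \<theta> w \<epsilon>, OF e] by blast
    have \<phi>': "\<phi> \<epsilon> = \<epsilon>" "\<phi> w = \<epsilon>"
      using TopStarL.prems False by (simp_all add: \<phi>(1))
    \<comment> \<open>The rule substitutes in the whole sequent, so the added contexts enter the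
      induction hypothesis with \<open>\<theta> w\<close> already replaced.\<close>
    show ?thesis
      using TopStarL.IH[of \<phi> "ant_map (sub \<epsilon> (\<theta> w)) \<Gamma>'" "suc_map (sub \<epsilon> (\<theta> w)) \<Delta>'"]
        TopStarL.prems \<phi>' \<phi>(2,3) False
      by (auto intro!: LS.TopStarL)
  qed
next
  case (StarL x y z A B \<Gamma> \<Delta>)
  let ?F = "labels (add_mset (Fm (\<theta> z \<^bold>: A \<^bold>* B)) (ant_map \<theta> \<Gamma> + \<Gamma>')) (suc_map \<theta> \<Delta> + \<Delta>')"
  obtain a where a: "Var a \<notin> ?F" by (rule fresh_label[OF finite_labels])
  obtain b where b: "Var b \<notin> insert (Var a) ?F"
    by (rule fresh_label[of "insert (Var a) ?F"]) (simp_all only: finite_insert finite_labels)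
  \<comment> \<open>The eigenlabels get fresh images. They do not occur in the conclusion, which
    therefore has the same image under \<open>\<phi>\<close> as under
    \<open>\<theta>\<close>.\<close>
  define \<phi> where "\<phi> = \<theta>(Var x := Var a, Var y := Var b)"
  have \<phi>: "\<phi> \<epsilon> = \<epsilon>" "\<phi> (Var x) = Var a" "\<phi> (Var y) = Var b" "\<phi> z = \<theta> z"
    "ant_map \<phi> \<Gamma> = ant_map \<theta> \<Gamma>" "suc_map \<phi> \<Delta> = suc_map \<theta> \<Delta>"
    using StarL.hyps StarL.prems by (auto simp: \<phi>_def intro!: map_cong_labels[of \<Gamma> \<Delta>])
  have "add_mset (Fm (\<theta> z \<^bold>: A \<^bold>* B)) (ant_map \<theta> \<Gamma> + \<Gamma>') \<turnstile>\<^sub>L\<^sub>S suc_map \<theta> \<Delta> + \<Delta>'"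
    using StarL.IH[of \<phi> \<Gamma>' \<Delta>'] StarL.hyps a b
    by (intro LS.StarL[of a b]) (auto simp: \<phi>)
  then show ?case by simp
next
  case (WandR x y z A \<Gamma> B \<Delta>)
  let ?F = "labels (ant_map \<theta> \<Gamma> + \<Gamma>') (add_mset (\<theta> y \<^bold>: A -\<^bold>* B) (suc_map \<theta> \<Delta> + \<Delta>'))"
  obtain a where a: "Var a \<notin> ?F" by (rule fresh_label[OF finite_labels])
  obtain b where b: "Var b \<notin> insert (Var a) ?F"
    by (rule fresh_label[of "insert (Var a) ?F"]) (simp_all only: finite_insert finite_labels)
  define \<phi> where "\<phi> = \<theta>(Var x := Var a, Var z := Var b)"
  have \<phi>: "\<phi> \<epsilon> = \<epsilon>" "\<phi> (Var x) = Var a" "\<phi> (Var z) = Var b" "\<phi> y = \<theta> y"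
    "ant_map \<phi> \<Gamma> = ant_map \<theta> \<Gamma>" "suc_map \<phi> \<Delta> = suc_map \<theta> \<Delta>"
    using WandR.hyps WandR.prems by (auto simp: \<phi>_def intro!: map_cong_labels[of \<Gamma> \<Delta>])
  have "ant_map \<theta> \<Gamma> + \<Gamma>' \<turnstile>\<^sub>L\<^sub>S add_mset (\<theta> y \<^bold>: A -\<^bold>* B) (suc_map \<theta> \<Delta> + \<Delta>')"
    using WandR.IH[of \<phi> \<Gamma>' \<Delta>'] WandR.hyps a b
    by (intro LS.WandR[of a _ b]) (auto simp: \<phi>)
  then show ?case by simp
next
  case (A u w z y v x \<Gamma> \<Delta>)
  let ?\<Gamma> = "add_mset (At (x, y \<triangleright> z)) (add_mset (At (u, v \<triangleright> x)) \<Gamma>)"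
  let ?F = "labels (ant_map \<theta> ?\<Gamma> + \<Gamma>') (suc_map \<theta> \<Delta> + \<Delta>')"
  obtain a where a: "Var a \<notin> ?F" by (rule fresh_label[OF finite_labels])
  define \<phi> where "\<phi> = \<theta>(Var w := Var a)"
  have \<phi>: "\<phi> \<epsilon> = \<epsilon>" "\<phi> (Var w) = Var a" "\<phi> u = \<theta> u" "\<phi> v = \<theta> v" "\<phi> x = \<theta> x" "\<phi> y = \<theta> y" "\<phi> z = \<theta> z"
    "ant_map \<phi> \<Gamma> = ant_map \<theta> \<Gamma>" "suc_map \<phi> \<Delta> = suc_map \<theta> \<Delta>"
    using A.hyps A.prems by (auto simp: \<phi>_def intro!: map_cong_labels[of \<Gamma> \<Delta>])
  show ?case
    using A.IH[of \<phi> \<Gamma>' \<Delta>'] a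
    by (auto simp: \<phi> intro!: LS.A[of _ a])
next
  case (AC x w y \<Gamma> \<Delta>)
  let ?F = "labels (ant_map \<theta> (add_mset (At (x, y \<triangleright> x)) \<Gamma>) + \<Gamma>') (suc_map \<theta> \<Delta> + \<Delta>')"
  obtain a where a: "Var a \<notin> ?F" by (rule fresh_label[OF finite_labels])
  define \<phi> where "\<phi> = \<theta>(Var w := Var a)"
  have \<phi>: "\<phi> \<epsilon> = \<epsilon>" "\<phi> (Var w) = Var a" "\<phi> x = \<theta> x" "\<phi> y = \<theta> y"
    "ant_map \<phi> \<Gamma> = ant_map \<theta> \<Gamma>" "suc_map \<phi> \<Delta> = suc_map \<theta> \<Delta>"
    using AC.hyps AC.prems by (auto simp: \<phi>_def intro!: map_cong_labels[of \<Gamma> \<Delta>])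
  show ?case
    using AC.IH[of \<phi> \<Gamma>' \<Delta>'] a
    by (auto simp: \<phi> intro!: LS.AC[of _ a])
next
  case (Eq1 w' w \<Gamma> \<Delta>)
  \<comment> \<open>The renamed principal atom is
    \<open>(\<epsilon>, \<theta> w \<triangleright> \<theta> w')\<close>. If
    \<open>\<theta> w\<close> is not \<epsilon>, \<open>Eq1\<close> still applies. If only
    \<open>\<theta> w\<close> is \<epsilon>, the direction is reversed and \<open>Eq2\<close>
    replaces \<open>\<theta> w'\<close> by \<epsilon>. If both are \<epsilon>, the renamed premise
    is the renamed conclusion. The case of \<open>Eq2\<close> is the mirror image.\<close>
  consider "\<theta> w \<noteq> \<epsilon>" | "\<theta> w = \<epsilon>" "\<theta> w' \<noteq> \<epsilon>" | "\<theta> w = \<epsilon>" "\<theta> w' = \<epsilon>" by blast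
  then show ?case
  proof cases
    case 1
    have e: "sub (\<theta> w') (\<theta> w) (\<theta> w) = sub (\<theta> w') (\<theta> w) (\<theta> w')" using Eq1.prems 1 by simp
    obtain \<phi> where \<phi>: "\<And>l. \<phi> l = sub (\<theta> w') (\<theta> w) (\<theta> l)"
      "\<And>\<Gamma> :: ('v, 'p) ant. ant_map \<phi> (ant_map (sub w' w) \<Gamma>) = ant_map (sub (\<theta> w') (\<theta> w)) (ant_map \<theta> \<Gamma>)"
      "\<And>\<Delta> :: ('v, 'p) suc. suc_map \<phi> (suc_map (sub w' w) \<Delta>) = suc_map (sub (\<theta> w') (\<theta> w)) (suc_map \<theta> \<Delta>)"
      using rename_sub[of "sub (\<theta> w') (\<theta> w)" \<theta> w w', OF e] by blast
    have \<phi>': "\<phi> \<epsilon> = \<epsilon>" "\<phi> w = \<theta> w'" "\<phi> w' = \<theta> w'"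
      using Eq1.prems 1 by (simp_all add: \<phi>(1))
    show ?thesis
      using Eq1.IH[of \<phi> "ant_map (sub (\<theta> w') (\<theta> w)) \<Gamma>'" "suc_map (sub (\<theta> w') (\<theta> w)) \<Delta>'"]
        \<phi>' \<phi>(2,3) Eq1.prems 1
      by simp (rule LS.Eq1, simp_all)
  next
    case 2
    have e: "sub \<epsilon> (\<theta> w') (\<theta> w) = sub \<epsilon> (\<theta> w') (\<theta> w')" using Eq1.prems 2 by simp
    obtain \<phi> where \<phi>: "\<And>l. \<phi> l = sub \<epsilon> (\<theta> w') (\<theta> l)"
      "\<And>\<Gamma> :: ('v, 'p) ant. ant_map \<phi> (ant_map (sub w' w) \<Gamma>) = ant_map (sub \<epsilon> (\<theta> w')) (ant_map \<theta> \<Gamma>)"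
      "\<And>\<Delta> :: ('v, 'p) suc. suc_map \<phi> (suc_map (sub w' w) \<Delta>) = suc_map (sub \<epsilon> (\<theta> w')) (suc_map \<theta> \<Delta>)"
      using rename_sub[of "sub \<epsilon> (\<theta> w')" \<theta> w w', OF e] by blast
    have \<phi>': "\<phi> \<epsilon> = \<epsilon>" "\<phi> w = \<epsilon>" "\<phi> w' = \<epsilon>"
      using Eq1.prems 2 by (simp_all add: \<phi>(1))
    show ?thesis
      using Eq1.IH[of \<phi> "ant_map (sub \<epsilon> (\<theta> w')) \<Gamma>'" "suc_map (sub \<epsilon> (\<theta> w')) \<Delta>'"]
        \<phi>' \<phi>(2,3) Eq1.prems 2
      by simp (rule LS.Eq2, simp_all)
  next
    case 3
    then show ?thesis using Eq1.IH[of \<theta> \<Gamma>' \<Delta>'] Eq1.prems by (simp add: map_comp comp_sub)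
  qed
next
  case (Eq2 w' w \<Gamma> \<Delta>)
  consider "\<theta> w \<noteq> \<epsilon>" | "\<theta> w = \<epsilon>" "\<theta> w' \<noteq> \<epsilon>" | "\<theta> w = \<epsilon>" "\<theta> w' = \<epsilon>" by blast
  then show ?case
  proof cases
    case 1
    have e: "sub (\<theta> w') (\<theta> w) (\<theta> w) = sub (\<theta> w') (\<theta> w) (\<theta> w')" using Eq2.prems 1 by simp
    obtain \<phi> where \<phi>: "\<And>l. \<phi> l = sub (\<theta> w') (\<theta> w) (\<theta> l)"
      "\<And>\<Gamma> :: ('v, 'p) ant. ant_map \<phi> (ant_map (sub w' w) \<Gamma>) = ant_map (sub (\<theta> w') (\<theta> w)) (ant_map \<theta> \<Gamma>)"
      "\<And>\<Delta> :: ('v, 'p) suc. suc_map \<phi> (suc_map (sub w' w) \<Delta>) = suc_map (sub (\<theta> w') (\<theta> w)) (suc_map \<theta> \<Delta>)"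
      using rename_sub[of "sub (\<theta> w') (\<theta> w)" \<theta> w w', OF e] by blast
    have \<phi>': "\<phi> \<epsilon> = \<epsilon>" "\<phi> w = \<theta> w'" "\<phi> w' = \<theta> w'"
      using Eq2.prems 1 by (simp_all add: \<phi>(1))
    show ?thesis
      using Eq2.IH[of \<phi> "ant_map (sub (\<theta> w') (\<theta> w)) \<Gamma>'" "suc_map (sub (\<theta> w') (\<theta> w)) \<Delta>'"]
        \<phi>' \<phi>(2,3) Eq2.prems 1
      by simp (rule LS.Eq2, simp_all)
  next
    case 2
    have e: "sub \<epsilon> (\<theta> w') (\<theta> w) = sub \<epsilon> (\<theta> w') (\<theta> w')" using Eq2.prems 2 by simp
    obtain \<phi> where \<phi>: "\<And>l. \<phi> l = sub \<epsilon> (\<theta> w') (\<theta> l)"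
      "\<And>\<Gamma> :: ('v, 'p) ant. ant_map \<phi> (ant_map (sub w' w) \<Gamma>) = ant_map (sub \<epsilon> (\<theta> w')) (ant_map \<theta> \<Gamma>)"
      "\<And>\<Delta> :: ('v, 'p) suc. suc_map \<phi> (suc_map (sub w' w) \<Delta>) = suc_map (sub \<epsilon> (\<theta> w')) (suc_map \<theta> \<Delta>)"
      using rename_sub[of "sub \<epsilon> (\<theta> w')" \<theta> w w', OF e] by blast
    have \<phi>': "\<phi> \<epsilon> = \<epsilon>" "\<phi> w = \<epsilon>" "\<phi> w' = \<epsilon>"
      using Eq2.prems 2 by (simp_all add: \<phi>(1))
    show ?thesis
      using Eq2.IH[of \<phi> "ant_map (sub \<epsilon> (\<theta> w')) \<Gamma>'" "suc_map (sub \<epsilon> (\<theta> w')) \<Delta>'"]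
        \<phi>' \<phi>(2,3) Eq2.prems 2
      by simp (rule LS.Eq1, simp_all)
  next
    case 3
    then show ?thesis using Eq2.IH[of \<theta> \<Gamma>' \<Delta>'] Eq2.prems by (simp add: map_comp comp_sub)
  qed
next
  case (StarR x y z \<Gamma> A B \<Delta>)
  then show ?case by (simp add: LS.StarR)
next
  case (WandL x y z A B \<Gamma> \<Delta>)
  then show ?case by (simp add: LS.WandL)
next
  case (U x \<Gamma> \<Delta>)
  from U.IH[of \<theta> \<Gamma>' \<Delta>'] U.prems show ?case by simp (rule LS.U)
next
  case (E y x z \<Gamma> \<Delta>)
  from E.IH[of \<theta> \<Gamma>' \<Delta>'] E.prems show ?case by simp (rule LS.E)
qed (simp_all add: LS.Id LS.BotL LS.TopR LS.TopStarR LS.AndL LS.AndR LS.ImpL LS.ImpR)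

lemma LS_rename:
  fixes \<Gamma> :: "('v::infinite, 'p) ant"
  assumes "\<Gamma> \<turnstile>\<^sub>L\<^sub>S \<Delta>" and "\<theta> \<epsilon> = \<epsilon>"
  shows "ant_map \<theta> \<Gamma> \<turnstile>\<^sub>L\<^sub>S suc_map \<theta> \<Delta>"
  using LS_rename_weaken[OF assms(1), of \<theta> "{#}" "{#}"] assms(2) by simp

text \<open>As \<epsilon> is never the replaced label, a step of a run amounts to applying its
  substitution to all atoms.\<close>

lemma added_eq: "admissible r \<Longrightarrow> added r = map_ratom (inst_sub r) (principal r)"
  by (cases r) simp_all

lemma subst_eps: "eq_run G \<sigma> \<noteq> None \<Longrightarrow> subst \<sigma> \<epsilon> = \<epsilon>"
proof (induction \<sigma> arbitrary: G)
  case (Cons r \<sigma>)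
  then have "admissible r" by (auto split: if_splits)
  then have "inst_sub r \<epsilon> = \<epsilon>" by (cases r) simp_all
  then show ?case using Cons by (auto split: if_splits)
qed simp

text \<open>\<open>Eq1\<close> and \<open>Eq2\<close> consume the principal atom and put back the
  added one. The latter is the image of the former, so the premise is the image of the complete
  conclusion and the steps compose.\<close>

lemma LS_eq_run:
  assumes "eq_run (ratoms \<Gamma>) \<sigma> \<noteq> None"
    and "ant_map (subst \<sigma>) \<Gamma> \<turnstile>\<^sub>L\<^sub>S suc_map (subst \<sigma>) \<Delta>"
  shows "\<Gamma> \<turnstile>\<^sub>L\<^sub>S \<Delta>"
  using assms
proof (induction \<sigma> arbitrary: \<Gamma> \<Delta>)
  case (Cons r \<sigma>)
  let ?s = "inst_sub r"
  from Cons.prems(1) have r: "admissible r" "principal r \<in> ratoms \<Gamma>"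
    and run: "eq_run (map_ratom ?s ` ratoms \<Gamma> \<union> {added r}) \<sigma> \<noteq> None"
    by (auto split: if_splits)
  from r(2) obtain \<Gamma>0 where \<Gamma>0: "\<Gamma> = add_mset (At (principal r)) \<Gamma>0"
    unfolding ratoms_def by (blast dest: multi_member_split)
  have "map_ratom ?s ` ratoms \<Gamma> \<union> {added r} = ratoms (ant_map ?s \<Gamma>)"
    using r by (auto simp: ratoms_ant_map added_eq)
  with run have "eq_run (ratoms (ant_map ?s \<Gamma>)) \<sigma> \<noteq> None" by simp
  moreover have "ant_map (subst \<sigma>) (ant_map ?s \<Gamma>) \<turnstile>\<^sub>L\<^sub>S suc_map (subst \<sigma>) (suc_map ?s \<Delta>)"
    using Cons.prems(2) by (simp only: map_comp subst.simps)
  ultimately have "ant_map ?s \<Gamma> \<turnstile>\<^sub>L\<^sub>S suc_map ?s \<Delta>" by (rule Cons.IH)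
  then have *: "add_mset (At (added r)) (ant_map ?s \<Gamma>0) \<turnstile>\<^sub>L\<^sub>S suc_map ?s \<Delta>"
    using r by (simp add: \<Gamma>0 added_eq)
  show ?case
  proof (cases r)
    case (Inst1 w w')
    with * r show ?thesis unfolding \<Gamma>0 by simp (rule LS.Eq1)
  next
    case (Inst2 w w')
    with * r show ?thesis unfolding \<Gamma>0 by simp (rule LS.Eq2)
  qed
qed simp

text \<open>The form in which side conditions of \<open>ILS\<close> are discharged: one passes to an
  image of the sequent in which the two labels coincide, and the ordinary \<open>LS\<close> rule
  applies there.\<close>

lemma eq_entails_LS:
  assumes "ratoms \<Gamma> \<turnstile>\<^sub>E (u = v)"
  shows "\<exists>\<theta>. \<theta> \<epsilon> = \<epsilon> \<and> \<theta> u = \<theta> v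
    \<and> (\<forall>\<Delta>. (ant_map \<theta> \<Gamma> \<turnstile>\<^sub>L\<^sub>S suc_map \<theta> \<Delta>) \<longrightarrow> (\<Gamma> \<turnstile>\<^sub>L\<^sub>S \<Delta>))"
proof -
  obtain \<sigma> where "eq_run (ratoms \<Gamma>) \<sigma> \<noteq> None" "subst \<sigma> u = subst \<sigma> v"
    using assms unfolding eq_entails_def by blast
  then show ?thesis using LS_eq_run subst_eps by (intro exI[of _ "subst \<sigma>"]) blast
qed

section \<open>Translation of \<open>ILS\<close> derivations\<close>

lemma ILS_imp_LS:
  fixes \<Gamma> :: "('v::infinite, 'p) ant"
  assumes "\<Gamma> \<turnstile>\<^sub>I\<^sub>L\<^sub>S \<Delta>"
  shows "\<Gamma> \<turnstile>\<^sub>L\<^sub>S \<Delta>"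
  using assms
proof (induction rule: ILS.induct)
  case (Id w1 P \<Gamma> w2 \<Delta>)
  from eq_entails_LS[OF this] obtain \<theta> where "\<theta> w1 = \<theta> w2"
    and lift: "\<And>\<Delta>. ant_map \<theta> (add_mset (Fm (w1 \<^bold>: Atom P)) \<Gamma>) \<turnstile>\<^sub>L\<^sub>S suc_map \<theta> \<Delta>
      \<Longrightarrow> add_mset (Fm (w1 \<^bold>: Atom P)) \<Gamma> \<turnstile>\<^sub>L\<^sub>S \<Delta>" by blast
  then show ?case by (intro lift) (simp add: LS.Id)
next
  case (TopStarL w \<Gamma> \<Delta>)
  show ?case
  \<comment> \<open>If \<open>w\<close> is \<epsilon>, the atom of the premise comes from
    \<open>U\<close> and the formula from weakening. Otherwise the substitution of
    \<open>LS.TopStarL\<close> turns the atom into an instance of \<open>U\<close>.\<close>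
  proof (cases "w = \<epsilon>")
    case True
    then have "\<Gamma> \<turnstile>\<^sub>L\<^sub>S \<Delta>" using TopStarL.IH LS.U by blast
    from LS_rename_weaken[OF this, where \<theta> = id and \<Gamma>' = "{#Fm (w \<^bold>: TopStar)#}" and \<Delta>' = "{#}"]
    show ?thesis by simp
  next
    case False
    with LS_rename[OF TopStarL.IH, of "sub \<epsilon> w"]
    have "ant_map (sub \<epsilon> w) \<Gamma> \<turnstile>\<^sub>L\<^sub>S suc_map (sub \<epsilon> w) \<Delta>" by (simp add: LS.U)
    with False show ?thesis by (simp add: LS.TopStarL)
  qed
next
  case (TopStarR \<Gamma> w \<Delta>)
  from eq_entails_LS[OF this] obtain \<theta> where "\<theta> \<epsilon> = \<epsilon>" "\<theta> w = \<theta> \<epsilon>"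
    and lift: "\<And>\<Delta>. ant_map \<theta> \<Gamma> \<turnstile>\<^sub>L\<^sub>S suc_map \<theta> \<Delta> \<Longrightarrow> \<Gamma> \<turnstile>\<^sub>L\<^sub>S \<Delta>" by blast
  then show ?case by (intro lift) (simp add: LS.TopStarR)
next
  case (StarR x y z' \<Gamma> A z B \<Delta>)
  obtain \<theta> where \<theta>: "\<theta> \<epsilon> = \<epsilon>" "\<theta> z = \<theta> z'"
    and lift: "\<And>\<Delta>. ant_map \<theta> (add_mset (At (x, y \<triangleright> z')) \<Gamma>) \<turnstile>\<^sub>L\<^sub>S suc_map \<theta> \<Delta>
      \<Longrightarrow> add_mset (At (x, y \<triangleright> z')) \<Gamma> \<turnstile>\<^sub>L\<^sub>S \<Delta>"
    using eq_entails_LS[OF StarR.hyps(3)] by blast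
  show ?case
    using StarR.IH(1)[THEN LS_rename, of \<theta>] StarR.IH(2)[THEN LS_rename, of \<theta>] \<theta>
    by - (rule lift, simp, rule LS.StarR)
next
  case (WandL x y' z y A B \<Gamma> \<Delta>)
  let ?\<Gamma> = "add_mset (At (x, y' \<triangleright> z)) (add_mset (Fm (y \<^bold>: A -\<^bold>* B)) \<Gamma>)"
  obtain \<theta> where \<theta>: "\<theta> \<epsilon> = \<epsilon>" "\<theta> y = \<theta> y'"
    and lift: "\<And>\<Delta>. ant_map \<theta> ?\<Gamma> \<turnstile>\<^sub>L\<^sub>S suc_map \<theta> \<Delta> \<Longrightarrow> ?\<Gamma> \<turnstile>\<^sub>L\<^sub>S \<Delta>"
    using eq_entails_LS[OF WandL.hyps(3)] by blast
  show ?case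
    using WandL.IH(1)[THEN LS_rename, of \<theta>] WandL.IH(2)[THEN LS_rename, of \<theta>] \<theta>
    by - (rule lift, simp, rule LS.WandL)
next
  case (A u w z y v x x' \<Gamma> \<Delta>)
  let ?\<Gamma> = "add_mset (At (x, y \<triangleright> z)) (add_mset (At (u, v \<triangleright> x')) \<Gamma>)"
  obtain \<theta> where \<theta>: "\<theta> \<epsilon> = \<epsilon>" "\<theta> x = \<theta> x'"
    and lift: "\<And>\<Delta>. ant_map \<theta> ?\<Gamma> \<turnstile>\<^sub>L\<^sub>S suc_map \<theta> \<Delta> \<Longrightarrow> ?\<Gamma> \<turnstile>\<^sub>L\<^sub>S \<Delta>"
    using eq_entails_LS[OF A.hyps(2)] by blast
  obtain a where a: "Var a \<notin> labels (ant_map \<theta> ?\<Gamma>) (suc_map \<theta> \<Delta>)"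
    by (rule fresh_label[OF finite_labels])
  \<comment> \<open>Nothing is known of \<open>\<theta>\<close> at the eigenlabel \<open>w\<close>.
    As \<open>w\<close> does not occur in the conclusion, it can be sent to a label fresh for the
    image.\<close>
  define \<phi> where "\<phi> = \<theta>(Var w := Var a)"
  have \<phi>: "\<phi> \<epsilon> = \<epsilon>" "\<phi> (Var w) = Var a" "\<phi> u = \<theta> u" "\<phi> v = \<theta> v" "\<phi> x = \<theta> x" "\<phi> x' = \<theta> x'" "\<phi> y = \<theta> y" "\<phi> z = \<theta> z"
    "ant_map \<phi> \<Gamma> = ant_map \<theta> \<Gamma>" "suc_map \<phi> \<Delta> = suc_map \<theta> \<Delta>"
    using A.hyps \<theta>(1) by (auto simp: \<phi>_def intro!: map_cong_labels[of \<Gamma> \<Delta>])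
  show ?case
    using LS_rename[OF A.IH, of \<phi>] a
    by - (rule lift, simp add: \<phi> \<theta>(2), rule LS.A[of _ a], simp_all)
next
  case (AC x w x' y \<Gamma> \<Delta>)
  let ?\<Gamma> = "add_mset (At (x, y \<triangleright> x')) \<Gamma>"
  obtain \<theta> where \<theta>: "\<theta> \<epsilon> = \<epsilon>" "\<theta> x = \<theta> x'"
    and lift: "\<And>\<Delta>. ant_map \<theta> ?\<Gamma> \<turnstile>\<^sub>L\<^sub>S suc_map \<theta> \<Delta> \<Longrightarrow> ?\<Gamma> \<turnstile>\<^sub>L\<^sub>S \<Delta>"
    using eq_entails_LS[OF AC.hyps(2)] by blast
  obtain a where a: "Var a \<notin> labels (ant_map \<theta> ?\<Gamma>) (suc_map \<theta> \<Delta>)"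
    by (rule fresh_label[OF finite_labels])
  define \<phi> where "\<phi> = \<theta>(Var w := Var a)"
  have \<phi>: "\<phi> \<epsilon> = \<epsilon>" "\<phi> (Var w) = Var a" "\<phi> x = \<theta> x" "\<phi> x' = \<theta> x'" "\<phi> y = \<theta> y"
    "ant_map \<phi> \<Gamma> = ant_map \<theta> \<Gamma>" "suc_map \<phi> \<Delta> = suc_map \<theta> \<Delta>"
    using AC.hyps \<theta>(1) by (auto simp: \<phi>_def intro!: map_cong_labels[of \<Gamma> \<Delta>])
  show ?case
    using LS_rename[OF AC.IH, of \<phi>] a
    by - (rule lift, simp add: \<phi> \<theta>(2), rule LS.AC[of _ a], simp_all)
next
  case (StarL x y z A B \<Gamma> \<Delta>)
  from StarL.IH StarL.hyps(2-) show ?case by (rule LS.StarL)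
next
  case (WandR x y z A \<Gamma> B \<Delta>)
  from WandR.IH WandR.hyps(2-) show ?case by (rule LS.WandR)
next
  case (U x \<Gamma> \<Delta>)
  from U.IH show ?case by (rule LS.U)
next
  case (E y x z \<Gamma> \<Delta>)
  from E.IH show ?case by (rule LS.E)
qed (assumption | rule LS.BotL LS.TopR LS.AndL LS.AndR LS.ImpL LS.ImpR)+


section \<open>Equality of labels as a congruence\<close>

text \<open>Transitivity is built in, whereas two runs that witness two equalities need not combine
  directly into one. In \<open>unit\<close> the first label is only equal to \<epsilon>, because
  earlier substitutions of a run can turn it into \<epsilon>.\<close>

inductive label_eq :: "'v label ratom set \<Rightarrow> 'v label \<Rightarrow> 'v label \<Rightarrow> bool" for G where
  refl: "label_eq G x x"
| sym: "label_eq G x y \<Longrightarrow> label_eq G y x"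
| trans: "label_eq G x y \<Longrightarrow> label_eq G y z \<Longrightarrow> label_eq G x z"
| unit: "(e, x \<triangleright> y) \<in> G \<Longrightarrow> label_eq G e \<epsilon> \<Longrightarrow> label_eq G x y"

lemma label_eq_mono: "label_eq G x y \<Longrightarrow> G \<subseteq> G' \<Longrightarrow> label_eq G' x y"
  by (induction rule: label_eq.induct) (blast intro: label_eq.intros)+

text \<open>As long as some atom \<open>(\<epsilon>, x \<triangleright> y)\<close> has distinct
  \<open>x\<close> and \<open>y\<close>, an instance applies and eliminates one label from the
  atoms. The number of labels that occur is therefore a termination measure.\<close>

lemma eq_run_saturate:
  assumes "finite G"
  shows "\<exists>\<sigma>. eq_run G \<sigma> = Some (map_ratom (subst \<sigma>) ` G)
    \<and> (\<forall>x y. (\<epsilon>, x \<triangleright> y) \<in> map_ratom (subst \<sigma>) ` G \<longrightarrow> x = y)"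
  using assms
proof (induction "card (\<Union> (set_ratom ` G))" arbitrary: G rule: less_induct)
  case less
  let ?L = "\<lambda>G. \<Union> (set_ratom ` G)"
  show ?case
  proof (cases "\<forall>x y. (\<epsilon>, x \<triangleright> y) \<in> G \<longrightarrow> x = y")
    case True
    then show ?thesis by (intro exI[of _ "[]"]) (simp add: ratom.map_id0)
  next
    case False
    then obtain x y where xy: "(\<epsilon>, x \<triangleright> y) \<in> G" "x \<noteq> y" by blast
    have in_L: "\<epsilon> \<in> ?L G" "x \<in> ?L G" "y \<in> ?L G" using xy(1) by force+
    obtain r s t where r: "admissible r" "principal r \<in> G" "inst_sub r = sub t s"
      and st: "s \<noteq> t" "s \<in> ?L G" "t \<in> ?L G"
    \<comment> \<open>The replaced label must differ from \<epsilon>, so it is \<open>y\<close> when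
      \<open>x\<close> is \<epsilon>.\<close>
    proof (cases "x = \<epsilon>")
      case True
      then show thesis using xy in_L that[of "Inst2 y \<epsilon>" \<epsilon> y] by simp
    next
      case False
      then show thesis using xy in_L that[of "Inst1 x y" y x] by simp
    qed
    let ?G = "map_ratom (inst_sub r) ` G"
    have "?L ?G = sub t s ` ?L G" by (simp add: ratom.set_map r(3) image_UN)
    also have "\<dots> \<subseteq> ?L G - {s}"
    proof
      fix l assume "l \<in> sub t s ` ?L G"
      then obtain l0 where "l0 \<in> ?L G" "l = sub t s l0" by blast
      then show "l \<in> ?L G - {s}" using st by (cases "l0 = s") auto
    qed
    also have "\<dots> \<subset> ?L G" using st(2) by blast
    finally have "card (?L ?G) < card (?L G)"
      using less.prems finite_set_ratom by (intro psubset_card_mono) auto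
    moreover have "finite ?G" using less.prems by simp
    ultimately obtain \<sigma> where \<sigma>: "eq_run ?G \<sigma> = Some (map_ratom (subst \<sigma>) ` ?G)"
      "\<forall>x y. (\<epsilon>, x \<triangleright> y) \<in> map_ratom (subst \<sigma>) ` ?G \<longrightarrow> x = y"
      using less.hyps by blast
    have "insert (added r) ?G = ?G" using r by (auto simp: added_eq)
    moreover have "map_ratom (subst \<sigma>) ` ?G = map_ratom (subst (r # \<sigma>)) ` G"
      by (simp add: image_image ratom.map_comp)
    ultimately show ?thesis using \<sigma> r by (intro exI[of _ "r # \<sigma>"]) simp
  qed
qed

text \<open>A single saturating run serves all equalities: the kernel of its substitution is an
  equivalence, and it is closed under \<open>unit\<close> because no nontrivial atom with first
  label \<epsilon> is left.\<close>

lemma label_eq_entails: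
  assumes "finite G" and "label_eq G u v"
  shows "G \<turnstile>\<^sub>E (u = v)"
proof -
  obtain \<sigma> where \<sigma>: "eq_run G \<sigma> = Some (map_ratom (subst \<sigma>) ` G)"
    "\<forall>x y. (\<epsilon>, x \<triangleright> y) \<in> map_ratom (subst \<sigma>) ` G \<longrightarrow> x = y"
    using eq_run_saturate[OF assms(1)] by blast
  have eps: "subst \<sigma> \<epsilon> = \<epsilon>" using subst_eps[of G \<sigma>] \<sigma>(1) by simp
  from assms(2) have "subst \<sigma> u = subst \<sigma> v"
  proof (induction rule: label_eq.induct)
    case (unit e x y)
    then have "(\<epsilon>, subst \<sigma> x \<triangleright> subst \<sigma> y) \<in> map_ratom (subst \<sigma>) ` G"
      using eps by force
    then show ?case using \<sigma>(2) by blast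
  qed simp_all
  then show ?thesis using \<sigma>(1) unfolding eq_entails_def by force
qed

section \<open>Relational atoms modulo equality of labels\<close>

definition rel :: "'v label ratom set \<Rightarrow> 'v label \<Rightarrow> 'v label \<Rightarrow> 'v label \<Rightarrow> bool" where
  "rel G x y z \<longleftrightarrow>
    (\<exists>x' y' z'. (x', y' \<triangleright> z') \<in> G \<and> label_eq G x x' \<and> label_eq G y y' \<and> label_eq G z z')"

lemma rel_atom: "(x, y \<triangleright> z) \<in> G \<Longrightarrow> rel G x y z"
  unfolding rel_def by (blast intro: label_eq.refl)

lemma rel_mono: "rel G x y z \<Longrightarrow> G \<subseteq> G' \<Longrightarrow> rel G' x y z"
  unfolding rel_def by (blast intro: label_eq_mono)

lemma rel_cong:
  "rel G x y z \<Longrightarrow> label_eq G x x' \<Longrightarrow> label_eq G y y' \<Longrightarrow> label_eq G z z' \<Longrightarrow> rel G x' y' z'"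
  unfolding rel_def by (meson label_eq.sym label_eq.trans)

lemma rel_unit: "rel G \<epsilon> x y \<Longrightarrow> label_eq G x y"
  unfolding rel_def by (meson label_eq.sym label_eq.trans label_eq.unit)


section \<open>Realization of labelled formulae in a sequent\<close>

type_synonym ('v, 'p) seq = "('v, 'p) ant \<times> ('v, 'p) suc"

abbreviation derivable :: "('v, 'p) seq \<Rightarrow> bool" where
  "derivable S \<equiv> fst S \<turnstile>\<^sub>I\<^sub>L\<^sub>S snd S"

abbreviation atoms :: "('v, 'p) seq \<Rightarrow> 'v label ratom set" where
  "atoms S \<equiv> ratoms (fst S)"

text \<open>A formula is realized if it occurs or if the active formulae and atoms of some premise of
  its logical rule are realized, so that applying the rule backwards preserves realization
  although the principal formula is consumed.\<close>

fun lreal rreal :: "('v, 'p) seq \<Rightarrow> 'v label \<Rightarrow> 'p form \<Rightarrow> bool" where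
  "lreal S x (Atom P) \<longleftrightarrow> Fm (x \<^bold>: Atom P) \<in># fst S"
| "lreal S x Top \<longleftrightarrow> Fm (x \<^bold>: Top) \<in># fst S"
| "lreal S x Bot \<longleftrightarrow> Fm (x \<^bold>: Bot) \<in># fst S"
| "lreal S x TopStar \<longleftrightarrow> Fm (x \<^bold>: TopStar) \<in># fst S \<or> label_eq (atoms S) x \<epsilon>"
| "lreal S x (A \<^bold>\<and> B) \<longleftrightarrow> Fm (x \<^bold>: A \<^bold>\<and> B) \<in># fst S \<or> lreal S x A \<and> lreal S x B"
| "lreal S x (A \<^bold>\<rightarrow> B) \<longleftrightarrow> Fm (x \<^bold>: A \<^bold>\<rightarrow> B) \<in># fst S \<or> rreal S x A \<or> lreal S x B"
| "lreal S x (A \<^bold>* B) \<longleftrightarrow> Fm (x \<^bold>: A \<^bold>* B) \<in># fst S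
    \<or> (\<exists>y z. rel (atoms S) y z x \<and> lreal S y A \<and> lreal S z B)"
| "lreal S x (A -\<^bold>* B) \<longleftrightarrow> Fm (x \<^bold>: A -\<^bold>* B) \<in># fst S"
| "rreal S x (Atom P) \<longleftrightarrow> x \<^bold>: Atom P \<in># snd S"
| "rreal S x Top \<longleftrightarrow> x \<^bold>: Top \<in># snd S"
| "rreal S x Bot \<longleftrightarrow> x \<^bold>: Bot \<in># snd S"
| "rreal S x TopStar \<longleftrightarrow> x \<^bold>: TopStar \<in># snd S"
| "rreal S x (A \<^bold>\<and> B) \<longleftrightarrow> x \<^bold>: A \<^bold>\<and> B \<in># snd S \<or> rreal S x A \<or> rreal S x B"
| "rreal S x (A \<^bold>\<rightarrow> B) \<longleftrightarrow> x \<^bold>: A \<^bold>\<rightarrow> B \<in># snd S \<or> lreal S x A \<and> rreal S x B"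
| "rreal S x (A \<^bold>* B) \<longleftrightarrow> x \<^bold>: A \<^bold>* B \<in># snd S"
| "rreal S x (A -\<^bold>* B) \<longleftrightarrow> x \<^bold>: A -\<^bold>* B \<in># snd S
    \<or> (\<exists>y z. rel (atoms S) y x z \<and> lreal S y A \<and> rreal S z B)"

lemma lreal_literal: "Fm (x \<^bold>: A) \<in># fst S \<Longrightarrow> lreal S x A"
  by (cases A) auto

lemma rreal_literal: "x \<^bold>: A \<in># snd S \<Longrightarrow> rreal S x A"
  by (cases A) auto

text \<open>Realization is preserved rather than occurrence, since a premise that has lost the
  principal formula of its rule must still extend the conclusion. Multiplicities do not
  count.\<close>

definition extends :: "('v, 'p) seq \<Rightarrow> ('v, 'p) seq \<Rightarrow> bool"  (infix "\<preceq>" 50) where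
  "S \<preceq> S' \<longleftrightarrow> atoms S \<subseteq> atoms S' \<and> (\<forall>x A. lreal S x A \<longrightarrow> lreal S' x A)
    \<and> (\<forall>x A. rreal S x A \<longrightarrow> rreal S' x A)"

lemma extends_refl: "S \<preceq> S"
  by (simp add: extends_def)

lemma extends_trans: "S \<preceq> S' \<Longrightarrow> S' \<preceq> S'' \<Longrightarrow> S \<preceq> S''"
  unfolding extends_def by blast

lemma extendsD:
  assumes "S \<preceq> S'"
  shows "lreal S x A \<Longrightarrow> lreal S' x A" and "rreal S x A \<Longrightarrow> rreal S' x A"
    and "label_eq (atoms S) x y \<Longrightarrow> label_eq (atoms S') x y"
    and "rel (atoms S) x y z \<Longrightarrow> rel (atoms S') x y z"
  using assms unfolding extends_def by (blast intro: label_eq_mono rel_mono)+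

text \<open>Realization is built monotonically from occurrences and atoms, so induction on formulae
  reduces it to occurrences.\<close>

lemma extendsI:
  assumes "atoms S \<subseteq> atoms S'"
    and l: "\<And>x A. Fm (x \<^bold>: A) \<in># fst S \<Longrightarrow> lreal S' x A"
    and r: "\<And>x A. x \<^bold>: A \<in># snd S \<Longrightarrow> rreal S' x A"
  shows "S \<preceq> S'"
proof -
  note mono = label_eq_mono[OF _ assms(1)] rel_mono[OF _ assms(1)]
  have "(lreal S x A \<longrightarrow> lreal S' x A) \<and> (rreal S x A \<longrightarrow> rreal S' x A)" for x A
  proof (induction A arbitrary: x)
    case (Star A B)
    then show ?case using l[of x "A \<^bold>* B"] r[of x "A \<^bold>* B"] mono(2) by auto blast
  next
    case (Wand A B)
    then show ?case using l[of x "A -\<^bold>* B"] r[of x "A -\<^bold>* B"] mono(2) by auto blast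
  next
    case TopStar
    then show ?case using l[of x TopStar] r[of x TopStar] mono(1) by auto
  next
    case (And A B)
    then show ?case using l[of x "A \<^bold>\<and> B"] r[of x "A \<^bold>\<and> B"] by auto
  next
    case (Imp A B)
    then show ?case using l[of x "A \<^bold>\<rightarrow> B"] r[of x "A \<^bold>\<rightarrow> B"] by auto
  qed (use l r in force)+
  then show ?thesis using assms(1) by (simp add: extends_def)
qed

lemma extends_subset:
  assumes "fst S \<subseteq># fst S'" and "snd S \<subseteq># snd S'"
  shows "S \<preceq> S'"
  using mset_subset_eqD[OF assms(1)] mset_subset_eqD[OF assms(2)]
  by (intro extendsI) (auto simp: ratoms_def intro: lreal_literal rreal_literal)


section \<open>The biorthogonality model\<close>

definition orth :: "(('v, 'p) seq \<Rightarrow> bool) \<Rightarrow> ('v, 'p) seq \<Rightarrow> bool" where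
  "orth X S \<longleftrightarrow> (\<forall>S'. S \<preceq> S' \<longrightarrow> X S' \<longrightarrow> derivable S')"

text \<open>Polarity records the side on which a compound formula is generated by its components:
  conjunctions on the left by two left meanings, implications on the right by a left and a right
  meaning.\<close>

primrec positive :: "'p form \<Rightarrow> bool" where
  "positive (Atom P) = True"
| "positive Top = True"
| "positive Bot = True"
| "positive TopStar = True"
| "positive (A \<^bold>\<and> B) = True"
| "positive (A \<^bold>\<rightarrow> B) = False"
| "positive (A \<^bold>* B) = True"
| "positive (A -\<^bold>* B) = False"

text \<open>Separating the closures from the generators lets \<open>gen\<close> recurse through them
  on subformulae. In either polarity the two closures of a persistent \<open>X\<close> are
  orthogonals of each other.\<close>

definition left_closure ::
    "'p form \<Rightarrow> (('v, 'p) seq \<Rightarrow> bool) \<Rightarrow> ('v, 'p) seq \<Rightarrow> bool" where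
  "left_closure A X = (if positive A then orth (orth X) else orth X)"

definition right_closure ::
    "'p form \<Rightarrow> (('v, 'p) seq \<Rightarrow> bool) \<Rightarrow> ('v, 'p) seq \<Rightarrow> bool" where
  "right_closure A X = (if positive A then orth X else orth (orth X))"

text \<open>The sequents that generate the left meaning of a positive formula and the right meaning
  of a negative one.\<close>

primrec gen :: "'p form \<Rightarrow> 'v label \<Rightarrow> ('v, 'p) seq \<Rightarrow> bool" where
  "gen (Atom P) = (\<lambda>x S. \<exists>y. label_eq (atoms S) x y \<and> lreal S y (Atom P))"
| "gen Top = (\<lambda>x S. True)"
| "gen Bot = (\<lambda>x S. False)"
| "gen TopStar = (\<lambda>x S. label_eq (atoms S) x \<epsilon>)"
| "gen (A \<^bold>\<and> B) = (\<lambda>x S. left_closure A (gen A x) S \<and> left_closure B (gen B x) S)"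
| "gen (A \<^bold>\<rightarrow> B) = (\<lambda>x S. left_closure A (gen A x) S \<and> right_closure B (gen B x) S)"
| "gen (A \<^bold>* B) = (\<lambda>z S. \<exists>x y. rel (atoms S) x y z
      \<and> left_closure A (gen A x) S \<and> left_closure B (gen B y) S)"
| "gen (A -\<^bold>* B) = (\<lambda>y S. \<exists>x z. rel (atoms S) x y z
      \<and> left_closure A (gen A x) S \<and> right_closure B (gen B z) S)"

abbreviation lden :: "'p form \<Rightarrow> 'v label \<Rightarrow> ('v, 'p) seq \<Rightarrow> bool" where
  "lden A x \<equiv> left_closure A (gen A x)"

abbreviation rden :: "'p form \<Rightarrow> 'v label \<Rightarrow> ('v, 'p) seq \<Rightarrow> bool" where
  "rden A x \<equiv> right_closure A (gen A x)"

section \<open>Persistence and duality of the two meanings\<close>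

lemma orth_mono: "S \<preceq> S' \<Longrightarrow> orth X S \<Longrightarrow> orth X S'"
  unfolding orth_def by (blast intro: extends_trans)

lemma lden_mono: "S \<preceq> S' \<Longrightarrow> lden A x S \<Longrightarrow> lden A x S'"
  unfolding left_closure_def by (auto intro: orth_mono split: if_splits)

lemma rden_mono: "S \<preceq> S' \<Longrightarrow> rden A x S \<Longrightarrow> rden A x S'"
  unfolding right_closure_def by (auto intro: orth_mono split: if_splits)

lemma gen_mono: "S \<preceq> S' \<Longrightarrow> gen A x S \<Longrightarrow> gen A x S'"
  using extendsD[of S S'] lden_mono[of S S'] rden_mono[of S S']
  by (cases A) (simp_all del: lreal.simps, blast+)

text \<open>The triple orthogonal in a Galois connection. Since \<open>orth\<close> looks at
  extensions, it is persistence that puts \<open>X\<close> inside its biorthogonal.\<close>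

lemma orth_orth_orth:
  assumes "\<And>S S'. S \<preceq> S' \<Longrightarrow> X S \<Longrightarrow> X S'"
  shows "orth (orth (orth X)) = orth X"
proof (intro ext iffI)
  fix S
  show "orth X S" if "orth (orth (orth X)) S"
    using that assms unfolding orth_def by (metis extends_refl)
  show "orth (orth (orth X)) S" if "orth X S"
    using that unfolding orth_def by (metis extends_refl extends_trans)
qed

lemma lden_orth: "lden A x = orth (rden A x)"
  using orth_orth_orth[of "gen A x", OF gen_mono]
  by (simp add: left_closure_def right_closure_def)

lemma rden_orth: "rden A x = orth (lden A x)"
  using orth_orth_orth[of "gen A x", OF gen_mono]
  by (simp add: left_closure_def right_closure_def)

lemma orthD: "orth X S \<Longrightarrow> X S \<Longrightarrow> derivable S"
  unfolding orth_def using extends_refl by blast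

lemma derivable_clash: "lden A x S \<Longrightarrow> rden A x S \<Longrightarrow> derivable S"
  by (metis lden_orth orthD)

lemma gen_rden: "positive A \<Longrightarrow> rden A x S \<Longrightarrow> gen A x S \<Longrightarrow> derivable S"
  by (simp add: right_closure_def orthD)

lemma gen_lden: "\<not> positive A \<Longrightarrow> lden A x S \<Longrightarrow> gen A x S \<Longrightarrow> derivable S"
  by (simp add: left_closure_def orthD)

lemma ldenI:
  "(\<And>S'. S \<preceq> S' \<Longrightarrow> rden A x S' \<Longrightarrow> derivable S') \<Longrightarrow> lden A x S"
  by (simp add: lden_orth orth_def)

lemma rdenI:
  "(\<And>S'. S \<preceq> S' \<Longrightarrow> lden A x S' \<Longrightarrow> derivable S') \<Longrightarrow> rden A x S"
  by (simp add: rden_orth orth_def)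

text \<open>Only generators have to be tested here, whereas \<open>rdenI\<close> tests the entire
  left meaning.\<close>

lemma rden_positiveI:
  "positive A \<Longrightarrow> (\<And>S'. S \<preceq> S' \<Longrightarrow> gen A x S' \<Longrightarrow> derivable S') \<Longrightarrow> rden A x S"
  by (simp add: right_closure_def orth_def)

lemma lden_negativeI:
  "\<not> positive A \<Longrightarrow> (\<And>S'. S \<preceq> S' \<Longrightarrow> gen A x S' \<Longrightarrow> derivable S') \<Longrightarrow> lden A x S"
  by (simp add: left_closure_def orth_def)

section \<open>Invariance under equality of labels\<close>

lemma orth_cong:
  assumes "\<And>S x y. label_eq (atoms S) x y \<Longrightarrow> X x S \<Longrightarrow> X y S"
    and "label_eq (atoms S) x y" and "orth (X x) S"
  shows "orth (X y) S"
  unfolding orth_def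
proof (intro allI impI)
  fix S' assume "S \<preceq> S'" "X y S'"
  then show "derivable S'"
    using assms extendsD(3) label_eq.sym unfolding orth_def by blast
qed

text \<open>Orthogonals preserve invariance, as equal labels stay equal in extensions. The
  hypothesis concerns the single formula \<open>A\<close>, so that the lemma applies to subformulae
  inside the induction for \<open>gen_cong\<close>.\<close>

lemma closure_cong:
  fixes S :: "('v, 'p) seq"
  assumes "\<And>(S :: ('v, 'p) seq) x y. label_eq (atoms S) x y \<Longrightarrow> gen A x S \<Longrightarrow> gen A y S"
    and "label_eq (atoms S) x y"
  shows "lden A x S \<Longrightarrow> lden A y S" and "rden A x S \<Longrightarrow> rden A y S"
proof -
  have 1: "orth (gen A y) S" if "label_eq (atoms S) x y" "orth (gen A x) S"
    for S :: "('v, 'p) seq" and x y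
    using that by (rule orth_cong[where X = "gen A", rotated]) (rule assms(1))
  have 2: "orth (orth (gen A y)) S" if "orth (orth (gen A x)) S"
    using assms(2) that by (rule orth_cong[where X = "\<lambda>x. orth (gen A x)", rotated]) (rule 1)
  show "lden A x S \<Longrightarrow> lden A y S" "rden A x S \<Longrightarrow> rden A y S"
    using 1[OF assms(2)] 2 by (auto simp: left_closure_def right_closure_def)
qed

lemma gen_cong: "label_eq (atoms S) x y \<Longrightarrow> gen A x S \<Longrightarrow> gen A y S"
proof (induction A arbitrary: S x y)
  case (Atom P)
  then show ?case by (auto intro: label_eq.sym label_eq.trans)
next
  case TopStar
  then show ?case by (auto intro: label_eq.sym label_eq.trans)
next
  case (And A B)
  have "lden A x S \<Longrightarrow> lden A y S"
    by (rule closure_cong(1)[OF _ And.prems(1)], rule And.IH(1))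
  moreover have "lden B x S \<Longrightarrow> lden B y S"
    by (rule closure_cong(1)[OF _ And.prems(1)], rule And.IH(2))
  ultimately show ?case using And.prems(2) by simp
next
  case (Imp A B)
  have "lden A x S \<Longrightarrow> lden A y S"
    by (rule closure_cong(1)[OF _ Imp.prems(1)], rule Imp.IH(1))
  moreover have "rden B x S \<Longrightarrow> rden B y S"
    by (rule closure_cong(2)[OF _ Imp.prems(1)], rule Imp.IH(2))
  ultimately show ?case using Imp.prems(2) by simp
next
  case (Star A B)
  then show ?case using rel_cong[OF _ label_eq.refl label_eq.refl] by simp blast
next
  case (Wand A B)
  then show ?case using rel_cong[OF _ label_eq.refl _ label_eq.refl] by simp blast
qed simp_all

lemma lden_cong: "label_eq (atoms S) x y \<Longrightarrow> lden A x S \<Longrightarrow> lden A y S"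
  by (rule closure_cong(1)[rotated]) (assumption+, rule gen_cong)

lemma rden_cong: "label_eq (atoms S) x y \<Longrightarrow> rden A x S \<Longrightarrow> rden A y S"
  by (rule closure_cong(2)[rotated]) (assumption+, rule gen_cong)

section \<open>Realized formulae belong to their meanings\<close>

lemma fresh_labels2:
  fixes \<Gamma> :: "('v::infinite, 'p) ant"
  obtains a b where "Var a \<notin> labels \<Gamma> \<Delta>" "Var b \<notin> labels \<Gamma> \<Delta>" "a \<noteq> b"
proof -
  obtain a where a: "Var a \<notin> labels \<Gamma> \<Delta>" by (rule fresh_label[OF finite_labels])
  obtain b where "Var b \<notin> insert (Var a) (labels \<Gamma> \<Delta>)"
    by (rule fresh_label[of "insert (Var a) (labels \<Gamma> \<Delta>)"]) (simp only: finite_insert finite_labels)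
  with a that show thesis by auto
qed

lemma label_eq_side_condition: "label_eq (ratoms \<Gamma>) u v \<Longrightarrow> ratoms \<Gamma> \<turnstile>\<^sub>E (u = v)"
  by (rule label_eq_entails[OF finite_ratoms])

lemma lden_top: "lden Top x S"
  by (rule ldenI) (rule gen_rden[of Top x], simp_all)

lemma rden_bot: "rden Bot x S"
  by (rule rden_positiveI) simp_all

text \<open>Induction on the formula, tested against its opposite meaning. If it is realized through
  its components, the induction hypothesis yields a clash. If it occurs itself, its rule is applied
  backwards: the premises extend the sequent and realize the components.\<close>

lemma realized_imp_meaning:
  fixes S :: "('v::infinite, 'p) seq"
  shows "(lreal S x A \<longrightarrow> lden A x S) \<and> (rreal S x A \<longrightarrow> rden A x S)"
proof (induction A arbitrary: S x)
  case (Atom P)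
  have "lden (Atom P) x S" if real: "lreal S x (Atom P)"
  proof (rule ldenI)
    fix S' assume S': "S \<preceq> S'" "rden (Atom P) x S'"
    have "gen (Atom P) x S'" using extendsD(1)[OF S'(1) real] label_eq.refl by auto
    then show "derivable S'" using gen_rden[OF _ S'(2)] by simp
  qed
  moreover have "rden (Atom P) x S" if real: "rreal S x (Atom P)"
  proof (rule rden_positiveI)
    fix S' assume S': "S \<preceq> S'" "gen (Atom P) x S'"
    \<comment> \<open>A generator of an atomic formula is an occurrence at an equal label, which is
      what the side condition of \<open>ILS.Id\<close> accepts.\<close>
    from S'(2) obtain y where y: "label_eq (atoms S') x y" "Fm (y \<^bold>: Atom P) \<in># fst S'" by auto
    moreover have "x \<^bold>: Atom P \<in># snd S'" using extendsD(2)[OF S'(1) real] by simp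
    ultimately obtain \<Gamma> \<Delta> where "fst S' = add_mset (Fm (y \<^bold>: Atom P)) \<Gamma>"
      "snd S' = add_mset (x \<^bold>: Atom P) \<Delta>" by (meson multi_member_split)
    then show "derivable S'"
      using label_eq_side_condition[OF label_eq.sym[OF y(1)]] by (simp add: ILS.Id)
  qed simp
  ultimately show ?case by blast
next
  case Top
  have "rden Top x S" if real: "rreal S x Top"
  proof (rule rdenI)
    fix S' assume "S \<preceq> S'"
    from extendsD(2)[OF this real] obtain \<Delta> where "snd S' = add_mset (x \<^bold>: Top) \<Delta>"
      by (auto dest: multi_member_split)
    then show "derivable S'" by (simp add: ILS.TopR)
  qed
  then show ?case using lden_top by blast
next
  case Bot
  have "lden Bot x S" if real: "lreal S x Bot"
  proof (rule ldenI)
    fix S' assume "S \<preceq> S'"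
    from extendsD(1)[OF this real] obtain \<Gamma> where "fst S' = add_mset (Fm (x \<^bold>: Bot)) \<Gamma>"
      by (auto dest: multi_member_split)
    then show "derivable S'" by (simp add: ILS.BotL)
  qed
  then show ?case using rden_bot by blast
next
  case TopStar
  have "lden TopStar x S" if real: "lreal S x TopStar"
  proof (rule ldenI)
    fix S' assume S': "S \<preceq> S'" "rden TopStar x S'"
    show "derivable S'"
    proof (cases "label_eq (atoms S') x \<epsilon>")
      case True
      then show ?thesis using gen_rden[OF _ S'(2)] by simp
    next
      case False
      then obtain \<Gamma> where \<Gamma>: "fst S' = add_mset (Fm (x \<^bold>: TopStar)) \<Gamma>"
        using extendsD(1)[OF S'(1) real] by (auto dest: multi_member_split)
      let ?S = "(add_mset (At (\<epsilon>, x \<triangleright> \<epsilon>)) \<Gamma>, snd S')"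
      \<comment> \<open>The new atom makes \<open>x\<close> equal to \<epsilon>, so the consumed
        formula remains realized.\<close>
      have eq: "label_eq (atoms ?S) x \<epsilon>"
        by (rule label_eq.unit[of \<epsilon>]) (simp_all add: label_eq.refl)
      have "S' \<preceq> ?S"
        by (rule extendsI) (use eq in \<open>auto simp: \<Gamma> intro: lreal_literal rreal_literal\<close>)
      from gen_rden[OF _ rden_mono[OF this S'(2)]] eq have "derivable ?S" by simp
      then show ?thesis using \<Gamma> by (simp add: ILS.TopStarL)
    qed
  qed
  moreover have "rden TopStar x S" if real: "rreal S x TopStar"
  proof (rule rden_positiveI)
    fix S' assume S': "S \<preceq> S'" "gen TopStar x S'"
    obtain \<Delta> where "snd S' = add_mset (x \<^bold>: TopStar) \<Delta>"
      using extendsD(2)[OF S'(1) real] by (auto dest: multi_member_split)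
    then show "derivable S'" using label_eq_side_condition[of "fst S'" x \<epsilon>] S'(2)
      by (simp add: ILS.TopStarR)
  qed simp
  ultimately show ?case by blast
next
  case (And A B)
  have "lden (A \<^bold>\<and> B) x S" if real: "lreal S x (A \<^bold>\<and> B)"
  proof (rule ldenI)
    fix S' assume S': "S \<preceq> S'" "rden (A \<^bold>\<and> B) x S'"
    show "derivable S'"
    proof (cases "lreal S' x A \<and> lreal S' x B")
      case True
      then show ?thesis using And.IH gen_rden[OF _ S'(2)] by simp
    next
      case False
      then obtain \<Gamma> where \<Gamma>: "fst S' = add_mset (Fm (x \<^bold>: A \<^bold>\<and> B)) \<Gamma>"
        using extendsD(1)[OF S'(1) real] by (auto dest: multi_member_split)
      let ?S = "(add_mset (Fm (x \<^bold>: A)) (add_mset (Fm (x \<^bold>: B)) \<Gamma>), snd S')"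
      have lit: "lreal ?S x A" "lreal ?S x B" by (rule lreal_literal, simp)+
      have "S' \<preceq> ?S"
        by (rule extendsI) (use lit in \<open>auto simp: \<Gamma> intro: lreal_literal rreal_literal\<close>)
      from gen_rden[OF _ rden_mono[OF this S'(2)]] have "derivable ?S"
        using lit And.IH by simp
      then show ?thesis using \<Gamma> by (simp add: ILS.AndL)
    qed
  qed
  moreover have "rden (A \<^bold>\<and> B) x S" if real: "rreal S x (A \<^bold>\<and> B)"
  proof (rule rden_positiveI)
    fix S' assume S': "S \<preceq> S'" "gen (A \<^bold>\<and> B) x S'"
    then have den: "lden A x S'" "lden B x S'" by simp_all
    show "derivable S'"
    proof (cases "rreal S' x A \<or> rreal S' x B")
      case True
      then show ?thesis using And.IH den derivable_clash by blast
    next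
      case False
      then obtain \<Delta> where \<Delta>: "snd S' = add_mset (x \<^bold>: A \<^bold>\<and> B) \<Delta>"
        using extendsD(2)[OF S'(1) real] by (auto dest: multi_member_split)
      \<comment> \<open>The two premises of \<open>ILS.AndR\<close> are alike; \<open>C\<close>
        stands for either component.\<close>
      have "derivable (fst S', add_mset (x \<^bold>: C) \<Delta>)"
        if C: "C = A \<or> C = B" for C
      proof -
        let ?S = "(fst S', add_mset (x \<^bold>: C) \<Delta>)"
        have lit: "rreal ?S x C" by (rule rreal_literal) simp
        have "S' \<preceq> ?S"
          by (rule extendsI) (use lit C in \<open>auto simp: \<Delta> intro: lreal_literal rreal_literal\<close>)
        then show ?thesis
          using C lit And.IH den lden_mono derivable_clash by blast
      qed
      then show ?thesis using \<Delta> by (simp add: ILS.AndR)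
    qed
  qed simp
  ultimately show ?case by blast
next
  case (Imp A B)
  have "lden (A \<^bold>\<rightarrow> B) x S" if real: "lreal S x (A \<^bold>\<rightarrow> B)"
  proof (rule lden_negativeI)
    fix S' assume S': "S \<preceq> S'" "gen (A \<^bold>\<rightarrow> B) x S'"
    then have den: "lden A x S'" "rden B x S'" by simp_all
    show "derivable S'"
    proof (cases "rreal S' x A \<or> lreal S' x B")
      case True
      then show ?thesis using Imp.IH den derivable_clash by blast
    next
      case False
      then obtain \<Gamma> where \<Gamma>: "fst S' = add_mset (Fm (x \<^bold>: A \<^bold>\<rightarrow> B)) \<Gamma>"
        using extendsD(1)[OF S'(1) real] by (auto dest: multi_member_split)
      let ?S1 = "(\<Gamma>, add_mset (x \<^bold>: A) (snd S'))"
      let ?S2 = "(add_mset (Fm (x \<^bold>: B)) \<Gamma>, snd S')"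
      have lit: "rreal ?S1 x A" "lreal ?S2 x B" by (auto intro: lreal_literal rreal_literal)
      have "S' \<preceq> ?S1"
        by (rule extendsI) (use lit in \<open>auto simp: \<Gamma> intro: lreal_literal rreal_literal\<close>)
      then have "derivable ?S1" using lit Imp.IH den lden_mono derivable_clash by blast
      moreover have "S' \<preceq> ?S2"
        by (rule extendsI) (use lit in \<open>auto simp: \<Gamma> intro: lreal_literal rreal_literal\<close>)
      then have "derivable ?S2" using lit Imp.IH den rden_mono derivable_clash by blast
      ultimately show ?thesis using \<Gamma> by (simp add: ILS.ImpL)
    qed
  qed simp
  moreover have "rden (A \<^bold>\<rightarrow> B) x S" if real: "rreal S x (A \<^bold>\<rightarrow> B)"
  proof (rule rdenI)
    fix S' assume S': "S \<preceq> S'" "lden (A \<^bold>\<rightarrow> B) x S'"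
    show "derivable S'"
    proof (cases "lreal S' x A \<and> rreal S' x B")
      case True
      then show ?thesis using Imp.IH gen_lden[OF _ S'(2)] by simp
    next
      case False
      then obtain \<Delta> where \<Delta>: "snd S' = add_mset (x \<^bold>: A \<^bold>\<rightarrow> B) \<Delta>"
        using extendsD(2)[OF S'(1) real] by (auto dest: multi_member_split)
      let ?S = "(add_mset (Fm (x \<^bold>: A)) (fst S'), add_mset (x \<^bold>: B) \<Delta>)"
      have lit: "lreal ?S x A" "rreal ?S x B" by (auto intro: lreal_literal rreal_literal)
      have "S' \<preceq> ?S"
        by (rule extendsI) (use lit in \<open>auto simp: \<Delta> intro: lreal_literal rreal_literal\<close>)
      from gen_lden[OF _ lden_mono[OF this S'(2)]] have "derivable ?S"
        using lit Imp.IH by simp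
      then show ?thesis using \<Delta> by (simp add: ILS.ImpR)
    qed
  qed
  ultimately show ?case by blast
next
  case (Star A B)
  have "lden (A \<^bold>* B) x S" if real: "lreal S x (A \<^bold>* B)"
  proof (rule ldenI)
    fix S' assume S': "S \<preceq> S'" "rden (A \<^bold>* B) x S'"
    show "derivable S'"
    proof (cases "\<exists>y z. rel (atoms S') y z x \<and> lreal S' y A \<and> lreal S' z B")
      case True
      then have "gen (A \<^bold>* B) x S'"
          using Star.IH unfolding gen.simps by blast
      then show ?thesis using gen_rden[OF _ S'(2)] by simp
    next
      case False
      then obtain \<Gamma> where \<Gamma>: "fst S' = add_mset (Fm (x \<^bold>: A \<^bold>* B)) \<Gamma>"
        using extendsD(1)[OF S'(1) real] by (auto dest: multi_member_split)
      obtain a b where ab: "Var a \<notin> labels (fst S') (snd S')" "Var b \<notin> labels (fst S') (snd S')" "a \<noteq> b"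
        by (rule fresh_labels2)
      let ?S = "(add_mset (At (Var a, Var b \<triangleright> x))
        (add_mset (Fm (Var a \<^bold>: A)) (add_mset (Fm (Var b \<^bold>: B)) \<Gamma>)), snd S')"
      have lit: "lreal ?S (Var a) A" "lreal ?S (Var b) B" "rel (atoms ?S) (Var a) (Var b) x"
        by (auto intro: lreal_literal rel_atom)
      \<comment> \<open>The components together with the new atom realize the consumed formula, so
        the premise extends \<open>S'\<close>.\<close>
      then have "lreal ?S x (A \<^bold>* B)" by auto
      then have ext: "S' \<preceq> ?S"
        by (intro extendsI) (auto simp: \<Gamma> simp del: lreal.simps intro: lreal_literal rreal_literal)
      have gen: "gen (A \<^bold>* B) x ?S"
        using lit Star.IH unfolding gen.simps by blast
      have "derivable ?S" by (rule gen_rden[OF _ rden_mono[OF ext S'(2)] gen]) simp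
      then show ?thesis using ab ILS.StarL[of a b x A B \<Gamma> "snd S'"] by (simp add: \<Gamma>)
    qed
  qed
  moreover have "rden (A \<^bold>* B) x S" if real: "rreal S x (A \<^bold>* B)"
  proof (rule rden_positiveI)
    fix S' assume S': "S \<preceq> S'" "gen (A \<^bold>* B) x S'"
    then obtain y z where "rel (atoms S') y z x" "lden A y S'" "lden B z S'" by auto
    \<comment> \<open>The rule needs a literal atom. Invariance moves the meanings of
      \<open>A\<close> and \<open>B\<close> to its labels and leaves only the equality of
      \<open>x\<close> and \<open>x'\<close> to the side condition.\<close>
    then obtain y' z' x' where at: "(y', z' \<triangleright> x') \<in> atoms S'" "label_eq (atoms S') x x'"
      and den: "lden A y' S'" "lden B z' S'"
      unfolding rel_def using lden_cong[of S'] by blast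
    obtain \<Delta> where \<Delta>: "snd S' = add_mset (x \<^bold>: A \<^bold>* B) \<Delta>"
      using extendsD(2)[OF S'(1) real] by (auto dest: multi_member_split)
    obtain \<Gamma> where \<Gamma>: "fst S' = add_mset (At (y', z' \<triangleright> x')) \<Gamma>"
      using at(1) by (auto simp: ratoms_def dest: multi_member_split)
    \<comment> \<open>\<open>ILS.StarR\<close> keeps its principal formula, so its premises extend
      \<open>S'\<close> by inclusion. The induction hypothesis enters as an assumption on
      \<open>C\<close>.\<close>
    have D: "derivable (fst S', add_mset (l \<^bold>: C) (snd S'))" if "lden C l S'"
      and "\<And>(S :: ('v, 'p) seq) x. rreal S x C \<longrightarrow> rden C x S" for l C
    proof -
      let ?S = "(fst S', add_mset (l \<^bold>: C) (snd S'))"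
      have "rreal ?S l C" by (rule rreal_literal) simp
      moreover have "S' \<preceq> ?S" by (rule extends_subset) simp_all
      ultimately show ?thesis using that lden_mono derivable_clash by blast
    qed
    have "derivable (fst S', add_mset (y' \<^bold>: A) (snd S'))" "derivable (fst S', add_mset (z' \<^bold>: B) (snd S'))"
      using D den Star.IH by blast+
    moreover have "atoms S' \<turnstile>\<^sub>E (x = x')" using at(2) by (rule label_eq_side_condition)
    ultimately show "derivable S'" unfolding \<Gamma> \<Delta> by (simp add: ILS.StarR)
  qed simp
  ultimately show ?case by blast
next
  case (Wand A B)
  have "lden (A -\<^bold>* B) x S" if real: "lreal S x (A -\<^bold>* B)"
  proof (rule lden_negativeI)
    fix S' assume S': "S \<preceq> S'" "gen (A -\<^bold>* B) x S'"
    then obtain y z where "rel (atoms S') y x z" "lden A y S'" "rden B z S'" by auto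
    then obtain y' z' x' where at: "(y', x' \<triangleright> z') \<in> atoms S'" "label_eq (atoms S') x x'"
      and den: "lden A y' S'" "rden B z' S'"
      unfolding rel_def using lden_cong[of S'] rden_cong[of S'] by blast
    have lit: "Fm (x \<^bold>: A -\<^bold>* B) \<in># fst S'"
      using extendsD(1)[OF S'(1) real] by simp
    have "At (y', x' \<triangleright> z') \<in># fst S'" using at(1) by (simp add: ratoms_def)
    with lit obtain \<Gamma> where \<Gamma>:
      "fst S' = add_mset (At (y', x' \<triangleright> z')) (add_mset (Fm (x \<^bold>: A -\<^bold>* B)) \<Gamma>)"
      by (metis add_mset_remove_trivial_eq insert_noteq_member item.distinct(1) multi_member_split)
    let ?S1 = "(fst S', add_mset (y' \<^bold>: A) (snd S'))"
    have "rreal ?S1 y' A" by (rule rreal_literal) simp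
    moreover have "S' \<preceq> ?S1" by (rule extends_subset) simp_all
    ultimately have "derivable ?S1" using Wand.IH den(1) lden_mono derivable_clash by blast
    moreover
    let ?S2 = "(add_mset (Fm (z' \<^bold>: B)) (fst S'), snd S')"
    have "lreal ?S2 z' B" by (rule lreal_literal) simp
    moreover have "S' \<preceq> ?S2" by (rule extends_subset) simp_all
    ultimately have "derivable ?S1" "derivable ?S2"
      using Wand.IH den(2) rden_mono derivable_clash by blast+
    then have "add_mset (At (y', x' \<triangleright> z')) (add_mset (Fm (x \<^bold>: A -\<^bold>* B)) \<Gamma>)
        \<turnstile>\<^sub>I\<^sub>L\<^sub>S add_mset (y' \<^bold>: A) (snd S')"
      "add_mset (At (y', x' \<triangleright> z')) (add_mset (Fm (x \<^bold>: A -\<^bold>* B)) (add_mset (Fm (z' \<^bold>: B)) \<Gamma>))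
        \<turnstile>\<^sub>I\<^sub>L\<^sub>S snd S'"
      unfolding \<Gamma> by (simp_all add: add_mset_commute)
    moreover have "atoms S' \<turnstile>\<^sub>E (x = x')" using at(2) by (rule label_eq_side_condition)
    ultimately show "derivable S'" unfolding \<Gamma> by (rule ILS.WandL)
  qed simp
  moreover have "rden (A -\<^bold>* B) x S" if real: "rreal S x (A -\<^bold>* B)"
  proof (rule rdenI)
    fix S' assume S': "S \<preceq> S'" "lden (A -\<^bold>* B) x S'"
    show "derivable S'"
    proof (cases "\<exists>y z. rel (atoms S') y x z \<and> lreal S' y A \<and> rreal S' z B")
      case True
      then have "gen (A -\<^bold>* B) x S'"
          using Wand.IH unfolding gen.simps by blast
      then show ?thesis using gen_lden[OF _ S'(2)] by simp
    next
      case False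
      then obtain \<Delta> where \<Delta>: "snd S' = add_mset (x \<^bold>: A -\<^bold>* B) \<Delta>"
        using extendsD(2)[OF S'(1) real] by (auto dest: multi_member_split)
      obtain a b where ab: "Var a \<notin> labels (fst S') (snd S')" "Var b \<notin> labels (fst S') (snd S')" "a \<noteq> b"
        by (rule fresh_labels2)
      let ?S = "(add_mset (At (Var a, x \<triangleright> Var b)) (add_mset (Fm (Var a \<^bold>: A)) (fst S')),
        add_mset (Var b \<^bold>: B) \<Delta>)"
      have lit: "lreal ?S (Var a) A" "rreal ?S (Var b) B" "rel (atoms ?S) (Var a) x (Var b)"
        by (auto intro: lreal_literal rreal_literal rel_atom)
      then have "rreal ?S x (A -\<^bold>* B)" by auto
      then have ext: "S' \<preceq> ?S"
        by (intro extendsI) (auto simp: \<Delta> simp del: rreal.simps intro: lreal_literal rreal_literal)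
      have gen: "gen (A -\<^bold>* B) x ?S"
        using lit Wand.IH unfolding gen.simps by blast
      have "derivable ?S" by (rule gen_lden[OF _ lden_mono[OF ext S'(2)] gen]) simp
      then show ?thesis using ab ILS.WandR[of a x b A "fst S'" B \<Delta>] by (simp add: \<Delta>)
    qed
  qed
  ultimately show ?case by blast
qed


section \<open>Adequacy for \<open>LS\<close>\<close>

text \<open>A would-be countermodel to the sequent: its labels are read as labels of the world
  \<open>S\<close>, and both sides impose conditions on \<open>S\<close>. Adequacy shows that every
  such world is derivable.\<close>

definition sat ::
    "('v label \<Rightarrow> 'v label) \<Rightarrow> ('v, 'p) seq \<Rightarrow> ('v, 'p) ant \<Rightarrow> ('v, 'p) suc \<Rightarrow> bool" where
  "sat \<theta> S \<Gamma> \<Delta> \<longleftrightarrow> (\<forall>x A. Fm (x \<^bold>: A) \<in># \<Gamma> \<longrightarrow> lden A (\<theta> x) S)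
    \<and> (\<forall>x y z. At (x, y \<triangleright> z) \<in># \<Gamma> \<longrightarrow> rel (atoms S) (\<theta> x) (\<theta> y) (\<theta> z))
    \<and> (\<forall>x A. x \<^bold>: A \<in># \<Delta> \<longrightarrow> rden A (\<theta> x) S)"

lemma sat_simps [simp]:
  "sat \<theta> S (add_mset (Fm (x \<^bold>: A)) \<Gamma>) \<Delta> \<longleftrightarrow> lden A (\<theta> x) S \<and> sat \<theta> S \<Gamma> \<Delta>"
  "sat \<theta> S (add_mset (At (x, y \<triangleright> z)) \<Gamma>) \<Delta> \<longleftrightarrow> rel (atoms S) (\<theta> x) (\<theta> y) (\<theta> z) \<and> sat \<theta> S \<Gamma> \<Delta>"
  "sat \<theta> S \<Gamma> (add_mset (x \<^bold>: A) \<Delta>) \<longleftrightarrow> rden A (\<theta> x) S \<and> sat \<theta> S \<Gamma> \<Delta>"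
  "sat \<theta> S (\<Gamma> + \<Gamma>') (\<Delta> + \<Delta>') \<longleftrightarrow> sat \<theta> S \<Gamma> \<Delta> \<and> sat \<theta> S \<Gamma>' \<Delta>'"
  unfolding sat_def by auto

lemma sat_mono: "S \<preceq> S' \<Longrightarrow> sat \<theta> S \<Gamma> \<Delta> \<Longrightarrow> sat \<theta> S' \<Gamma> \<Delta>"
  unfolding sat_def using lden_mono[of S S'] rden_mono[of S S'] extendsD(4)[of S S'] by blast

lemma labels_memI:
  "Fm (x \<^bold>: A) \<in># \<Gamma> \<Longrightarrow> x \<in> labels \<Gamma> \<Delta>"
  "At (x, y \<triangleright> z) \<in># \<Gamma> \<Longrightarrow> {x, y, z} \<subseteq> labels \<Gamma> \<Delta>"
  "x \<^bold>: A \<in># \<Delta> \<Longrightarrow> x \<in> labels \<Gamma> \<Delta>"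
  unfolding labels_def by force+

lemma sat_cong:
  assumes "\<And>l. l \<in> labels \<Gamma> \<Delta> \<Longrightarrow> \<theta> l = \<theta>' l"
  shows "sat \<theta> S \<Gamma> \<Delta> \<longleftrightarrow> sat \<theta>' S \<Gamma> \<Delta>"
proof -
  have "\<theta> x = \<theta>' x" if "Fm (x \<^bold>: A) \<in># \<Gamma>" for x A
    using assms labels_memI(1)[OF that] by blast
  moreover have "\<theta> x = \<theta>' x \<and> \<theta> y = \<theta>' y \<and> \<theta> z = \<theta>' z" if "At (x, y \<triangleright> z) \<in># \<Gamma>" for x y z
    using assms labels_memI(2)[OF that] by blast
  moreover have "\<theta> x = \<theta>' x" if "x \<^bold>: A \<in># \<Delta>" for x A
    using assms labels_memI(3)[OF that] by blast
  ultimately show ?thesis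
    unfolding sat_def by (intro conj_cong iff_allI imp_cong) simp_all
qed

lemma sat_upd_fresh:
  "l \<notin> labels \<Gamma> \<Delta> \<Longrightarrow> sat (\<theta>(l := t)) S \<Gamma> \<Delta> \<longleftrightarrow> sat \<theta> S \<Gamma> \<Delta>"
  by (rule sat_cong) auto

lemma mem_mapE:
  "Fm (x \<^bold>: A) \<in># ant_map \<theta> \<Gamma> \<Longrightarrow> \<exists>x'. Fm (x' \<^bold>: A) \<in># \<Gamma> \<and> x = \<theta> x'"
  "At (x, y \<triangleright> z) \<in># ant_map \<theta> \<Gamma>
    \<Longrightarrow> \<exists>x' y' z'. At (x', y' \<triangleright> z') \<in># \<Gamma> \<and> x = \<theta> x' \<and> y = \<theta> y' \<and> z = \<theta> z'"
  "x \<^bold>: A \<in># suc_map \<theta> \<Delta> \<Longrightarrow> \<exists>x'. x' \<^bold>: A \<in># \<Delta> \<and> x = \<theta> x'"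
proof -
  show "\<exists>x'. Fm (x' \<^bold>: A) \<in># \<Gamma> \<and> x = \<theta> x'" if "Fm (x \<^bold>: A) \<in># ant_map \<theta> \<Gamma>"
  proof -
    from that obtain i where "i \<in># \<Gamma>" "Fm (x \<^bold>: A) = map_item \<theta> i" by (auto simp: ant_map_def)
    moreover then obtain f where "i = Fm f" by (cases i) auto
    ultimately show ?thesis by (cases f) auto
  qed
  show "\<exists>x' y' z'. At (x', y' \<triangleright> z') \<in># \<Gamma> \<and> x = \<theta> x' \<and> y = \<theta> y' \<and> z = \<theta> z'"
    if "At (x, y \<triangleright> z) \<in># ant_map \<theta> \<Gamma>"
  proof -
    from that obtain i where "i \<in># \<Gamma>" "At (x, y \<triangleright> z) = map_item \<theta> i" by (auto simp: ant_map_def)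
    moreover then obtain a where "i = At a" by (cases i) auto
    ultimately show ?thesis by (cases a) auto
  qed
  show "\<exists>x'. x' \<^bold>: A \<in># \<Delta> \<and> x = \<theta> x'" if "x \<^bold>: A \<in># suc_map \<theta> \<Delta>"
  proof -
    from that obtain f where "f \<in># \<Delta>" "x \<^bold>: A = map_lform \<theta> f" by (auto simp: suc_map_def)
    then show ?thesis by (cases f) auto
  qed
qed

text \<open>Meanings and \<open>rel\<close> do not distinguish equal labels, so the same
  \<open>\<theta>\<close> also interprets the substituted sequent. This handles the premises of
  \<open>TopStarL\<close>, \<open>Eq1\<close> and \<open>Eq2\<close>.\<close>

lemma sat_sub:
  assumes eq: "label_eq (atoms S) (\<theta> w) (\<theta> w')" and sat: "sat \<theta> S \<Gamma> \<Delta>"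
  shows "sat \<theta> S (ant_map (sub w' w) \<Gamma>) (suc_map (sub w' w) \<Delta>)"
proof -
  have sub: "label_eq (atoms S) (\<theta> x) (\<theta> (sub w' w x))" for x
    using eq by (cases "x = w") (simp_all add: label_eq.refl)
  show ?thesis
    unfolding sat_def
  proof (intro conjI allI impI)
    fix x A assume "Fm (x \<^bold>: A) \<in># ant_map (sub w' w) \<Gamma>"
    then obtain x' where "Fm (x' \<^bold>: A) \<in># \<Gamma>" "x = sub w' w x'" by (blast dest: mem_mapE)
    then show "lden A (\<theta> x) S" using sat lden_cong[OF sub] unfolding sat_def by blast
  next
    fix x A assume "x \<^bold>: A \<in># suc_map (sub w' w) \<Delta>"
    then obtain x' where "x' \<^bold>: A \<in># \<Delta>" "x = sub w' w x'" by (blast dest: mem_mapE)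
    then show "rden A (\<theta> x) S" using sat rden_cong[OF sub] unfolding sat_def by blast
  next
    fix x y z assume "At (x, y \<triangleright> z) \<in># ant_map (sub w' w) \<Gamma>"
    then obtain x' y' z' where "At (x', y' \<triangleright> z') \<in># \<Gamma>"
      "x = sub w' w x'" "y = sub w' w y'" "z = sub w' w z'" by (blast dest: mem_mapE)
    then show "rel (atoms S) (\<theta> x) (\<theta> y) (\<theta> z)"
      using sat rel_cong[OF _ sub sub sub] unfolding sat_def by blast
  qed
qed

section \<open>Structural rules for the atoms of a world\<close>

lemma derivable_E:
  assumes "(x, y \<triangleright> z) \<in> atoms S" and "derivable (add_mset (At (y, x \<triangleright> z)) (fst S), snd S)"
  shows "derivable S"
proof -
  obtain \<Gamma> where "fst S = add_mset (At (x, y \<triangleright> z)) \<Gamma>"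
    using assms(1) by (auto simp: ratoms_def dest: multi_member_split)
  then show ?thesis using assms(2) by (simp add: ILS.E[of y x z])
qed

text \<open>The two atoms may be the same occurrence, which is what \<open>AC\<close> is for.\<close>

lemma derivable_A:
  assumes at: "(x, y \<triangleright> z) \<in> atoms S" "(u, v \<triangleright> x') \<in> atoms S" "label_eq (atoms S) x x'"
    and fresh: "Var w \<notin> labels (fst S) (snd S)"
    and der: "derivable (add_mset (At (u, Var w \<triangleright> z)) (add_mset (At (y, v \<triangleright> Var w)) (fst S)), snd S)"
  shows "derivable S"
proof -
  have eq: "atoms S \<turnstile>\<^sub>E (x = x')" using at(3) by (rule label_eq_side_condition)
  obtain \<Gamma> where \<Gamma>: "fst S = add_mset (At (x, y \<triangleright> z)) \<Gamma>"
    using at(1) by (auto simp: ratoms_def dest: multi_member_split)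
  show ?thesis
  proof (cases "(u, v \<triangleright> x') = (x, y \<triangleright> z)")
    case True
    then have *: "u = x" "v = y" "x' = z" by simp_all
    from der eq fresh show ?thesis
      unfolding \<Gamma> * by (simp only: fst_conv snd_conv) (rule ILS.AC)
  next
    case False
    then obtain \<Gamma>' where \<Gamma>': "\<Gamma> = add_mset (At (u, v \<triangleright> x')) \<Gamma>'"
      using at(2) by (auto simp: \<Gamma> ratoms_def dest: multi_member_split)
    from der eq fresh show ?thesis
      unfolding \<Gamma> \<Gamma>' by (simp only: fst_conv snd_conv) (rule ILS.A)
  qed
qed

text \<open>This covers both \<open>LS.A\<close> and \<open>LS.AC\<close>, since two facts about
  \<open>rel\<close> may stem from one atom. The literal atoms behind them share their common label
  only up to equality, which the side conditions of the \<open>ILS\<close> rules accept.\<close>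

lemma adequacy_A:
  fixes S :: "('v::infinite, 'p) seq"
  assumes IH: "\<And>S' l. S \<preceq> S' \<Longrightarrow> rel (atoms S') u l z \<Longrightarrow> rel (atoms S') y v l \<Longrightarrow> derivable S'"
    and rel: "rel (atoms S) x y z" "rel (atoms S) u v x"
  shows "derivable S"
proof -
  obtain x1 y1 z1 where 1: "(x1, y1 \<triangleright> z1) \<in> atoms S" "label_eq (atoms S) x x1"
    "label_eq (atoms S) y y1" "label_eq (atoms S) z z1"
    using rel(1) unfolding rel_def by blast
  obtain u2 v2 x2 where 2: "(u2, v2 \<triangleright> x2) \<in> atoms S" "label_eq (atoms S) u u2"
    "label_eq (atoms S) v v2" "label_eq (atoms S) x x2"
    using rel(2) unfolding rel_def by blast
  obtain w where w: "Var w \<notin> labels (fst S) (snd S)" by (rule fresh_label[OF finite_labels])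
  let ?S = "(add_mset (At (u2, Var w \<triangleright> z1)) (add_mset (At (y1, v2 \<triangleright> Var w)) (fst S)), snd S)"
  have ext: "S \<preceq> ?S" by (rule extends_subset) (auto simp: subset_mset.le_iff_add)
  have "rel (atoms ?S) u2 (Var w) z1" "rel (atoms ?S) y1 v2 (Var w)"
    by (rule rel_atom, simp)+
  moreover have "label_eq (atoms ?S) u2 u" "label_eq (atoms ?S) z1 z"
    "label_eq (atoms ?S) y1 y" "label_eq (atoms ?S) v2 v"
    by (rule extendsD(3)[OF ext], rule label_eq.sym, rule 1 2)+
  ultimately have "rel (atoms ?S) u (Var w) z" "rel (atoms ?S) y v (Var w)"
    by (blast intro: rel_cong label_eq.refl)+
  with ext have "derivable ?S" by (rule IH)
  moreover have "label_eq (atoms S) x1 x2" using 1(2) 2(4) by (blast intro: label_eq.sym label_eq.trans)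
  ultimately show ?thesis using derivable_A[OF 1(1) 2(1) _ w] by blast
qed

text \<open>Rules such as \<open>AndL\<close> and \<open>ImpR\<close>, whose premise describes a
  generator, give the principal formula the opposite meaning. Rules such as \<open>AndR\<close> and
  \<open>ImpL\<close> give the active formulae their opposite meanings and thus assemble a
  generator. Either way the meaning assumed by \<open>sat\<close> is contradicted.\<close>

lemma adequacy:
  fixes \<Gamma> :: "('v::infinite, 'p) ant"
  assumes "\<Gamma> \<turnstile>\<^sub>L\<^sub>S \<Delta>" and "\<theta> \<epsilon> = \<epsilon>" and "sat \<theta> S \<Gamma> \<Delta>"
  shows "derivable S"
  using assms
proof (induction arbitrary: \<theta> S rule: LS.induct)
  case (Id w P \<Gamma> \<Delta>)
  then show ?case by (auto simp del: gen.simps intro: derivable_clash)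
next
  case (Cut \<Gamma> x A \<Delta> \<Gamma>' \<Delta>')
  from Cut.prems have sat: "sat \<theta> S \<Gamma> \<Delta>" "sat \<theta> S \<Gamma>' \<Delta>'" by simp_all
  \<comment> \<open>By the first premise every extension of \<open>S\<close> in the right meaning of
    \<open>A\<close> is derivable. By duality \<open>S\<close> is in the left meaning, as the second
    premise requires.\<close>
  have "lden A (\<theta> x) S"
    by (rule ldenI, rule Cut.IH(1)[of \<theta>])
      (use Cut.prems(1) sat_mono[OF _ sat(1)] in \<open>simp_all del: gen.simps\<close>)
  then show ?case using Cut.IH(2)[of \<theta> S] Cut.prems(1) sat(2) by simp
next
  case (BotL w \<Gamma> \<Delta>)
  then show ?case unfolding sat_simps by (blast intro: derivable_clash rden_bot)
next
  case (TopR \<Gamma> w \<Delta>)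
  then show ?case unfolding sat_simps by (blast intro: derivable_clash lden_top)
next
  case (TopStarL w \<Gamma> \<Delta>)
  have "rden TopStar (\<theta> w) S"
  proof (rule rden_positiveI)
    fix S' assume S': "S \<preceq> S'" "gen TopStar (\<theta> w) S'"
    have "sat \<theta> S' \<Gamma> \<Delta>" using TopStarL.prems(2) sat_mono[OF S'(1)] by simp
    then show "derivable S'"
      using S'(2) TopStarL.prems(1) by (intro TopStarL.IH[of \<theta>] sat_sub) simp_all
  qed simp
  then show ?case using TopStarL.prems(2) unfolding sat_simps by (blast intro: derivable_clash)
next
  case (TopStarR \<Gamma> \<Delta>)
  have "gen TopStar (\<theta> \<epsilon>) S" using TopStarR.prems by (simp add: label_eq.refl)
  then show ?case using TopStarR.prems(2) gen_rden[of TopStar "\<theta> \<epsilon>" S] by (simp del: gen.simps)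
next
  case (AndL w A B \<Gamma> \<Delta>)
  have "rden (A \<^bold>\<and> B) (\<theta> w) S"
  proof (rule rden_positiveI)
    fix S' assume S': "S \<preceq> S'" "gen (A \<^bold>\<and> B) (\<theta> w) S'"
    have "sat \<theta> S' \<Gamma> \<Delta>" using AndL.prems(2) sat_mono[OF S'(1)] by simp
    then show "derivable S'" using S'(2) AndL.prems(1) by (intro AndL.IH[of \<theta>]) simp_all
  qed simp
  then show ?case using AndL.prems(2) unfolding sat_simps by (blast intro: derivable_clash)
next
  case (AndR \<Gamma> w A \<Delta> B)
  from AndR.prems have den: "rden (A \<^bold>\<and> B) (\<theta> w) S" and sat: "sat \<theta> S \<Gamma> \<Delta>"
    by (simp_all del: gen.simps)
  have "lden A (\<theta> w) S"
    by (rule ldenI, rule AndR.IH(1)[of \<theta>])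
      (use AndR.prems(1) sat_mono[OF _ sat] in \<open>simp_all del: gen.simps\<close>)
  moreover have "lden B (\<theta> w) S"
    by (rule ldenI, rule AndR.IH(2)[of \<theta>])
      (use AndR.prems(1) sat_mono[OF _ sat] in \<open>simp_all del: gen.simps\<close>)
  ultimately show ?case using gen_rden[OF _ den] by simp
next
  case (ImpL \<Gamma> w A \<Delta> B)
  from ImpL.prems have den: "lden (A \<^bold>\<rightarrow> B) (\<theta> w) S" and sat: "sat \<theta> S \<Gamma> \<Delta>"
    by (simp_all del: gen.simps)
  have "lden A (\<theta> w) S"
    by (rule ldenI, rule ImpL.IH(1)[of \<theta>])
      (use ImpL.prems(1) sat_mono[OF _ sat] in \<open>simp_all del: gen.simps\<close>)
  moreover have "rden B (\<theta> w) S"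
    by (rule rdenI, rule ImpL.IH(2)[of \<theta>])
      (use ImpL.prems(1) sat_mono[OF _ sat] in \<open>simp_all del: gen.simps\<close>)
  ultimately show ?case using gen_lden[OF _ den] by simp
next
  case (ImpR w A \<Gamma> B \<Delta>)
  have "lden (A \<^bold>\<rightarrow> B) (\<theta> w) S"
  proof (rule lden_negativeI)
    fix S' assume S': "S \<preceq> S'" "gen (A \<^bold>\<rightarrow> B) (\<theta> w) S'"
    have "sat \<theta> S' \<Gamma> \<Delta>" using ImpR.prems(2) sat_mono[OF S'(1)] by simp
    then show "derivable S'" using S'(2) ImpR.prems(1) by (intro ImpR.IH[of \<theta>]) simp_all
  qed simp
  then show ?case using ImpR.prems(2) unfolding sat_simps by (blast intro: derivable_clash)
next
  case (StarL x y z A B \<Gamma> \<Delta>)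
  have "rden (A \<^bold>* B) (\<theta> z) S"
  proof (rule rden_positiveI)
    fix S' assume S': "S \<preceq> S'" "gen (A \<^bold>* B) (\<theta> z) S'"
    have sat: "sat \<theta> S' \<Gamma> \<Delta>" using StarL.prems(2) sat_mono[OF S'(1)] by simp
    obtain a b where ab: "rel (atoms S') a b (\<theta> z)" "lden A a S'" "lden B b S'"
      using S'(2) by auto
    \<comment> \<open>The generator supplies the labels that interpret the eigenlabels. They can be
      arbitrary, since the context does not contain the eigenlabels.\<close>
    define \<phi> where "\<phi> = \<theta>(Var x := a, Var y := b)"
    have \<phi>: "\<phi> \<epsilon> = \<epsilon>" "\<phi> (Var x) = a" "\<phi> (Var y) = b" "\<phi> z = \<theta> z" "sat \<phi> S' \<Gamma> \<Delta>"
      using StarL.hyps(2-) StarL.prems(1) sat by (auto simp: \<phi>_def sat_upd_fresh)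
    show "derivable S'" using \<phi> ab by (intro StarL.IH[of \<phi>]) simp_all
  qed simp
  then show ?case using StarL.prems(2) unfolding sat_simps by (blast intro: derivable_clash)
next
  case (WandR x y z A \<Gamma> B \<Delta>)
  have "lden (A -\<^bold>* B) (\<theta> y) S"
  proof (rule lden_negativeI)
    fix S' assume S': "S \<preceq> S'" "gen (A -\<^bold>* B) (\<theta> y) S'"
    have sat: "sat \<theta> S' \<Gamma> \<Delta>" using WandR.prems(2) sat_mono[OF S'(1)] by simp
    obtain a b where ab: "rel (atoms S') a (\<theta> y) b" "lden A a S'" "rden B b S'"
      using S'(2) by auto
    define \<phi> where "\<phi> = \<theta>(Var x := a, Var z := b)"
    have \<phi>: "\<phi> \<epsilon> = \<epsilon>" "\<phi> (Var x) = a" "\<phi> (Var z) = b" "\<phi> y = \<theta> y" "sat \<phi> S' \<Gamma> \<Delta>"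
      using WandR.hyps(2-) WandR.prems(1) sat by (auto simp: \<phi>_def sat_upd_fresh)
    show "derivable S'" using \<phi> ab by (intro WandR.IH[of \<phi>]) simp_all
  qed simp
  then show ?case using WandR.prems(2) unfolding sat_simps by (blast intro: derivable_clash)
next
  case (StarR x y z \<Gamma> A B \<Delta>)
  from StarR.prems have den: "rden (A \<^bold>* B) (\<theta> z) S"
    and sat: "sat \<theta> S (add_mset (At (x, y \<triangleright> z)) \<Gamma>) (add_mset (z \<^bold>: A \<^bold>* B) \<Delta>)"
    by (simp_all del: gen.simps)
  have "lden A (\<theta> x) S"
    by (rule ldenI, rule StarR.IH(1)[of \<theta>])
      (use StarR.prems(1) sat_mono[OF _ sat] in \<open>simp_all del: gen.simps\<close>)
  moreover have "lden B (\<theta> y) S"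
    by (rule ldenI, rule StarR.IH(2)[of \<theta>])
      (use StarR.prems(1) sat_mono[OF _ sat] in \<open>simp_all del: gen.simps\<close>)
  ultimately have "gen (A \<^bold>* B) (\<theta> z) S" using sat by auto
  then show ?case using gen_rden[OF _ den] by simp
next
  case (WandL x y z A B \<Gamma> \<Delta>)
  from WandL.prems have den: "lden (A -\<^bold>* B) (\<theta> y) S"
    and sat: "sat \<theta> S (add_mset (At (x, y \<triangleright> z)) (add_mset (Fm (y \<^bold>: A -\<^bold>* B)) \<Gamma>)) \<Delta>"
    by (simp_all del: gen.simps)
  have "lden A (\<theta> x) S"
    by (rule ldenI, rule WandL.IH(1)[of \<theta>])
      (use WandL.prems(1) sat_mono[OF _ sat] in \<open>simp_all del: gen.simps\<close>)
  moreover have "rden B (\<theta> z) S"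
    by (rule rdenI, rule WandL.IH(2)[of \<theta>])
      (use WandL.prems(1) sat_mono[OF _ sat] in \<open>simp_all del: gen.simps\<close>)
  ultimately have "gen (A -\<^bold>* B) (\<theta> y) S" using sat by auto
  then show ?case using gen_lden[OF _ den] by simp
next
  case (E y x z \<Gamma> \<Delta>)
  then obtain x' y' z' where at: "(x', y' \<triangleright> z') \<in> atoms S"
    and eq: "label_eq (atoms S) (\<theta> x) x'" "label_eq (atoms S) (\<theta> y) y'" "label_eq (atoms S) (\<theta> z) z'"
    unfolding sat_simps rel_def by blast
  \<comment> \<open>The exchange is made on the literal atom, whose labels equal the images under
    \<open>\<theta>\<close>.\<close>
  let ?S = "(add_mset (At (y', x' \<triangleright> z')) (fst S), snd S)"
  have ext: "S \<preceq> ?S" by (rule extends_subset) simp_all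
  have "rel (atoms ?S) (\<theta> y) (\<theta> x) (\<theta> z)"
    using eq[THEN extendsD(3)[OF ext]] unfolding rel_def by auto
  then have "derivable ?S" using E.prems(1) sat_mono[OF ext E.prems(2)] by (intro E.IH[of \<theta>]) simp_all
  then show ?case by (rule derivable_E[OF at])
next
  case (U x \<Gamma> \<Delta>)
  let ?S = "(add_mset (At (\<theta> x, \<epsilon> \<triangleright> \<theta> x)) (fst S), snd S)"
  have ext: "S \<preceq> ?S" by (rule extends_subset) simp_all
  have "rel (atoms ?S) (\<theta> x) \<epsilon> (\<theta> x)" by (rule rel_atom) simp
  then have "derivable ?S" using U.prems(1) sat_mono[OF ext U.prems(2)] by (intro U.IH[of \<theta>]) simp_all
  then show ?case by simp (rule ILS.U)
next
  case (A u w z y v x \<Gamma> \<Delta>)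
  show ?case
  proof (rule adequacy_A[of S "\<theta> u" "\<theta> z" "\<theta> y" "\<theta> v" "\<theta> x"])
    fix S' l assume S': "S \<preceq> S'" "rel (atoms S') (\<theta> u) l (\<theta> z)" "rel (atoms S') (\<theta> y) (\<theta> v) l"
    define \<phi> where "\<phi> = \<theta>(Var w := l)"
    have \<phi>: "\<phi> \<epsilon> = \<epsilon>" "\<phi> (Var w) = l" "\<phi> u = \<theta> u" "\<phi> v = \<theta> v" "\<phi> x = \<theta> x" "\<phi> y = \<theta> y" "\<phi> z = \<theta> z"
      "sat \<phi> S' \<Gamma> \<Delta> = sat \<theta> S' \<Gamma> \<Delta>"
      using A.hyps(2-) A.prems(1) by (auto simp: \<phi>_def sat_upd_fresh)
    show "derivable S'"
      using \<phi> S'(2,3) sat_mono[OF S'(1) A.prems(2)] by (intro A.IH[of \<phi>]) simp_all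
  qed (use A.prems in simp_all)
next
  case (AC x w y \<Gamma> \<Delta>)
  show ?case
  \<comment> \<open>Both relations required by \<open>adequacy_A\<close> are the one given by the
    principal atom.\<close>
  proof (rule adequacy_A[of S "\<theta> x" "\<theta> x" "\<theta> y" "\<theta> y" "\<theta> x"])
    fix S' l assume S': "S \<preceq> S'" "rel (atoms S') (\<theta> x) l (\<theta> x)" "rel (atoms S') (\<theta> y) (\<theta> y) l"
    define \<phi> where "\<phi> = \<theta>(Var w := l)"
    have \<phi>: "\<phi> \<epsilon> = \<epsilon>" "\<phi> (Var w) = l" "\<phi> x = \<theta> x" "\<phi> y = \<theta> y"
      "sat \<phi> S' \<Gamma> \<Delta> = sat \<theta> S' \<Gamma> \<Delta>"
      using AC.hyps(2-) AC.prems(1) by (auto simp: \<phi>_def sat_upd_fresh)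
    show "derivable S'"
      using \<phi> S'(2,3) sat_mono[OF S'(1) AC.prems(2)] by (intro AC.IH[of \<phi>]) simp_all
  qed (use AC.prems in simp_all)
next
  case (Eq1 w' w \<Gamma> \<Delta>)
  then have rel: "rel (atoms S) \<epsilon> (\<theta> w) (\<theta> w')" and sat: "sat \<theta> S \<Gamma> \<Delta>" by simp_all
  \<comment> \<open>The principal atom forces the equality within \<open>S\<close>, so
    \<open>S\<close> itself is left unchanged.\<close>
  from rel have eq: "label_eq (atoms S) (\<theta> w) (\<theta> w')" by (rule rel_unit)
  have "rel (atoms S) \<epsilon> (\<theta> w') (\<theta> w')"
    using rel label_eq.refl eq label_eq.refl by (rule rel_cong)
  then show ?case using sat_sub[OF eq sat] Eq1.prems(1) by (intro Eq1.IH[of \<theta>]) simp_all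
next
  case (Eq2 w' w \<Gamma> \<Delta>)
  then have rel: "rel (atoms S) \<epsilon> (\<theta> w') (\<theta> w)" and sat: "sat \<theta> S \<Gamma> \<Delta>" by simp_all
  from rel have eq: "label_eq (atoms S) (\<theta> w) (\<theta> w')" by (rule label_eq.sym[OF rel_unit])
  have "rel (atoms S) \<epsilon> (\<theta> w') (\<theta> w')"
    using rel label_eq.refl label_eq.refl eq by (rule rel_cong)
  then show ?case using sat_sub[OF eq sat] Eq2.prems(1) by (intro Eq2.IH[of \<theta>]) simp_all
qed

section \<open>Equivalence of the two calculi\<close>

lemma LS_imp_ILS:
  fixes \<Gamma> :: "('v::infinite, 'p) ant"
  assumes "\<Gamma> \<turnstile>\<^sub>L\<^sub>S \<Delta>"
  shows "\<Gamma> \<turnstile>\<^sub>I\<^sub>L\<^sub>S \<Delta>"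
proof -
  let ?S = "(\<Gamma>, \<Delta>)"
  have "lden A x ?S" if "Fm (x \<^bold>: A) \<in># \<Gamma>" for x A
    using realized_imp_meaning lreal_literal[of x A ?S] that by auto
  moreover have "rden A x ?S" if "x \<^bold>: A \<in># \<Delta>" for x A
    using realized_imp_meaning rreal_literal[of x A ?S] that by auto
  ultimately have "sat id ?S \<Gamma> \<Delta>" by (simp add: sat_def rel_atom ratoms_def)
  from adequacy[OF assms _ this] show ?thesis by simp
qed

theorem theorem4:
  fixes \<Gamma> :: "('v::infinite, 'p) ant" and \<Delta> :: "('v, 'p) suc"
  shows "\<Gamma> \<turnstile>\<^sub>L\<^sub>S \<Delta> \<longleftrightarrow> \<Gamma> \<turnstile>\<^sub>I\<^sub>L\<^sub>S \<Delta>"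
  using LS_imp_ILS ILS_imp_LS by blast

end
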